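(* Let $\mathbb{F}$ be a finitely generated free group, $V$ a finite set, $\mathcal{L}:V\to\mathbb{F}$ an injective map, by which we identify $V$ with a subset of $\mathbb{F}$. Let $\Pi=(\Pi_{v,w})_{v,w\in V}$ be a stochastic matrix with a stationary distribution $\nu$ satisfying $\nu(v)>0$ for all $v\in V$, and let $G=(V,E)$ be its associated directed graph. Suppose $G$ is strongly connected and that for every $(a,b)\in E$ one has $(b^{-1},a^{-1})\in E$ (in particular $a^{-1},b^{-1}\in V$), where inverses are taken in $\mathbb{F}$. If there exist $v,w,u\in V$ such that $(v,w),(u,w),(u,v^{-1})\in E$, then $G$ contains a good subgraph, i.e. a good subgraph of order $k$ for some $k\ge 1$. Consequently, if in addition there is some $v\in V$ with $\Gamma_v=\mathbb{F}$, then for every $k$ such that $G$ contains a good subgraph of order $k$, every probability-measure-preserving action $\mathbb{F}\curvearrowright(X,\mu)$ and every $f\in L^1(X,\mu)$, the averages $$\frac{1}{2k}\sum_{i=0}^{2k-1}S_{n+i}f$$ converge in $L^1(X,\mu)$ as $n\to\infty$ to $\mathbb{E}[f|\mathbb{F}]$, the conditional expectation of $f$ on the sigma-algebra of $\mathbb{F}$-invariant measurable subsets of $X$.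
   Context: Stochastic means $\Pi_{v,w}\ge 0$ and $\sum_{w}\Pi_{v,w}=1$ for every $v\in V$. A stationary distribution is a probability distribution $\nu:V\to[0,1]$ with $\sum_{v\in V}\nu(v)\Pi_{v,w}=\nu(w)$ for every $w\in V$. The directed graph associated with $\Pi$ is $G=(V,E)$ with $E=\{(w,v)\in V\times V:\ \Pi_{v,w}>0\}$ (note the reversed order). A directed path in $G$ of length $n$ is a sequence $s=(s_1,\dots,s_n)\in V^n$ with $(s_i,s_{i+1})\in E$ for $1\le i<n$. For $s=(s_1,\dots,s_n)\in V^n$ put $\mathcal{L}(s)=\mathcal{L}(s_1)\cdots\mathcal{L}(s_n)\in\mathbb{F}$ and $\Pi_s=\Pi_{s_n,s_{n-1}}\cdots\Pi_{s_2,s_1}$ (equal to $1$ if $n=1$). Juxtaposition of paths and vertices denotes concatenation of sequences. A probability-measure-preserving action $\mathbb{F}\curvearrowright(X,\mu)$ is a homomorphism $T:\mathbb{F}\to \mathrm{Aut}(X,\mu)$, $g\mapsto T_g$, into the group of measure-preserving transformations of the probability space $(X,\mu)$. Write $T_s=T_{\mathcal{L}(s)}$. The spherical averages are $$S_n(\phi)(x)=\sum_{s=(s_1,\dots,s_n)\in V^n}\nu(s_n)\,\Pi_s\,\phi(T_s x),\qquad \phi\in L^1(X,\mu).$$ $G$ contains a good subgraph of order $k$ if there are vertices $u,w\in V$ and directed paths $p,q,p^*,q^*$ of length $k$ such that $upw$, $uqw$, $pq^*p$, $qp^*q$ are directed paths in $G$, and $\mathcal{L}(p^* )=\mathcal{L}(p)^{-1}$,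 $\mathcal{L}(q^* )=\mathcal{L}(q)^{-1}$. For $v\in V$, $\Gamma_v\le\mathbb{F}$ is the subgroup generated by all $\mathcal{L}(p)$ where $p=(p_1,\dots,p_n)$ ($n\ge1$) is a directed path in $G$ with $p_1=v$ and $(p_n,v)\in E$. *)

theory Defs
  imports "HOL-Algebra.Generated_Groups" "HOL-Probability.Probability"
begin

section \<open>Finitely generated free groups\<close>

text \<open>
  A word is a list of signed letters; \<open>(True, x)\<close> stands for \<open>x\<close> and \<open>(False, x)\<close> for its inverse.
  A reduced word contains no two adjacent mutually inverse letters.
\<close>

definition reduced_word :: "(bool \<times> 'g) list \<Rightarrow> bool" where
  "reduced_word ws \<longleftrightarrow> successively (\<lambda>a b. \<not> (snd a = snd b \<and> fst a \<noteq> fst b)) ws"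

definition word_value :: "('g, 'm) monoid_scheme \<Rightarrow> (bool \<times> 'g) list \<Rightarrow> 'g" where
  "word_value F ws =
     foldr (\<otimes>\<^bsub>F\<^esub>) (map (\<lambda>(e, x). if e then x else inv\<^bsub>F\<^esub> x) ws) \<one>\<^bsub>F\<^esub>"

definition freely_generates :: "('g, 'm) monoid_scheme \<Rightarrow> 'g set \<Rightarrow> bool" where
  "freely_generates F B \<longleftrightarrow>
     B \<subseteq> carrier F \<and> generate F B = carrier F \<and>
     (\<forall>ws. ws \<noteq> [] \<and> snd ` set ws \<subseteq> B \<and> reduced_word ws \<longrightarrow> word_value F ws \<noteq> \<one>\<^bsub>F\<^esub>)"

definition fg_free_group :: "('g, 'm) monoid_scheme \<Rightarrow> bool" where
  "fg_free_group F \<longleftrightarrow>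
     group F \<and> (\<exists>B. freely_generates F B) \<and>
     (\<exists>S. finite S \<and> S \<subseteq> carrier F \<and> generate F S = carrier F)"


section \<open>Stochastic matrices and their labelled graphs\<close>

definition stochastic :: "'v set \<Rightarrow> ('v \<Rightarrow> 'v \<Rightarrow> real) \<Rightarrow> bool" where
  "stochastic V P \<longleftrightarrow>
     (\<forall>v\<in>V. \<forall>w\<in>V. 0 \<le> P v w) \<and> (\<forall>v\<in>V. (\<Sum>w\<in>V. P v w) = 1)"

definition stationary_distribution ::
    "'v set \<Rightarrow> ('v \<Rightarrow> 'v \<Rightarrow> real) \<Rightarrow> ('v \<Rightarrow> real) \<Rightarrow> bool" where
  "stationary_distribution V P \<nu> \<longleftrightarrow>
     (\<forall>v\<in>V. 0 \<le> \<nu> v) \<and> (\<Sum>v\<in>V. \<nu> v) = 1 \<and>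
     (\<forall>w\<in>V. (\<Sum>v\<in>V. \<nu> v * P v w) = \<nu> w)"

text \<open>Edges run against the direction of the transitions.\<close>

definition edges :: "'v set \<Rightarrow> ('v \<Rightarrow> 'v \<Rightarrow> real) \<Rightarrow> ('v \<times> 'v) set" where
  "edges V P = {(w, v). w \<in> V \<and> v \<in> V \<and> 0 < P v w}"

definition strongly_connected :: "'v set \<Rightarrow> ('v \<times> 'v) set \<Rightarrow> bool" where
  "strongly_connected V E \<longleftrightarrow> (\<forall>v\<in>V. \<forall>w\<in>V. (v, w) \<in> E\<^sup>*)"

definition directed_path :: "'v set \<Rightarrow> ('v \<times> 'v) set \<Rightarrow> 'v list \<Rightarrow> bool" where
  "directed_path V E s \<longleftrightarrow> set s \<subseteq> V \<and> successively (\<lambda>a b. (a, b) \<in> E) s"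

definition path_label :: "('g, 'm) monoid_scheme \<Rightarrow> ('v \<Rightarrow> 'g) \<Rightarrow> 'v list \<Rightarrow> 'g" where
  "path_label F L s = foldr (\<otimes>\<^bsub>F\<^esub>) (map L s) \<one>\<^bsub>F\<^esub>"

definition path_weight :: "('v \<Rightarrow> 'v \<Rightarrow> real) \<Rightarrow> 'v list \<Rightarrow> real" where
  "path_weight P s = (\<Prod>i<length s - 1. P (s ! Suc i) (s ! i))"

text \<open>
  The vertex set is identified with a subset of the group through \<open>L\<close>:  \<open>a'\<close> is the vertex
  \<open>a\<^sup>-\<^sup>1\<close> when it is a vertex whose label is the inverse of the label of \<open>a\<close>.
\<close>

definition inverse_vertex ::
    "('g, 'm) monoid_scheme \<Rightarrow> 'v set \<Rightarrow> ('v \<Rightarrow> 'g) \<Rightarrow> 'v \<Rightarrow> 'v \<Rightarrow> bool" where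
  "inverse_vertex F V L a a' \<longleftrightarrow> a' \<in> V \<and> L a' = inv\<^bsub>F\<^esub> L a"

definition good_subgraph ::
    "('g, 'm) monoid_scheme \<Rightarrow> 'v set \<Rightarrow> ('v \<Rightarrow> 'g) \<Rightarrow> ('v \<times> 'v) set \<Rightarrow> nat \<Rightarrow> bool" where
  "good_subgraph F V L E k \<longleftrightarrow>
     (\<exists>u\<in>V. \<exists>w\<in>V. \<exists>p q p' q'.
        length p = k \<and> length q = k \<and> length p' = k \<and> length q' = k \<and>
        directed_path V E p \<and> directed_path V E q \<and>
        directed_path V E p' \<and> directed_path V E q' \<and>
        directed_path V E (u # p @ [w]) \<and> directed_path V E (u # q @ [w]) \<and>
        directed_path V E (p @ q' @ p) \<and> directed_path V E (q @ p' @ q) \<and>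
        path_label F L p' = inv\<^bsub>F\<^esub> path_label F L p \<and>
        path_label F L q' = inv\<^bsub>F\<^esub> path_label F L q)"

definition loop_group ::
    "('g, 'm) monoid_scheme \<Rightarrow> 'v set \<Rightarrow> ('v \<Rightarrow> 'g) \<Rightarrow> ('v \<times> 'v) set \<Rightarrow> 'v \<Rightarrow> 'g set" where
  "loop_group F V L E v =
     generate F {path_label F L p | p.
       directed_path V E p \<and> p \<noteq> [] \<and> hd p = v \<and> (last p, v) \<in> E}"


section \<open>Measure-preserving actions and spherical averages\<close>

text \<open>
  Measure-preserving transformations are identified when they agree almost everywhere, so the
  homomorphism property is required almost everywhere only. Invertibility of each \<open>T g\<close> modulo
  null sets follows. Actions in the pointwise sense are a special case.
\<close>

definition pmp_action :: "('g, 'm) monoid_scheme \<Rightarrow> 'x measure \<Rightarrow> ('g \<Rightarrow> 'x \<Rightarrow> 'x) \<Rightarrow> bool" where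
  "pmp_action F M T \<longleftrightarrow>
     prob_space M \<and>
     (\<forall>g\<in>carrier F. T g \<in> measurable M M \<and> distr M M (T g) = M) \<and>
     (AE x in M. T \<one>\<^bsub>F\<^esub> x = x) \<and>
     (\<forall>g\<in>carrier F. \<forall>h\<in>carrier F. AE x in M. T (g \<otimes>\<^bsub>F\<^esub> h) x = T g (T h x))"

text \<open>
  Accordingly, invariance of a measurable set is understood modulo null sets. The two lemmas below
  show that these sets form a \<open>\<sigma>\<close>-algebra and that for pointwise actions each of them agrees
  almost everywhere with a strictly invariant set, so that the conditional expectation is the one
  on the \<open>\<sigma>\<close>-algebra of strictly invariant sets.
\<close>

definition invariant_algebra ::
    "('g, 'm) monoid_scheme \<Rightarrow> 'x measure \<Rightarrow> ('g \<Rightarrow> 'x \<Rightarrow> 'x) \<Rightarrow> 'x measure" where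
  "invariant_algebra F M T =
     sigma (space M) {A \<in> sets M. \<forall>g\<in>carrier F. AE x in M. T g x \<in> A \<longleftrightarrow> x \<in> A}"

lemma sets_invariant_algebra:
  fixes M :: "'x measure"
  assumes "pmp_action F M T"
  shows "sets (invariant_algebra F M T) =
    {A \<in> sets M. \<forall>g\<in>carrier F. AE x in M. T g x \<in> A \<longleftrightarrow> x \<in> A}" (is "_ = ?I")
proof -
  have meas: "T g x \<in> space M" if "g \<in> carrier F" "x \<in> space M" for g x
    using assms that unfolding pmp_action_def by (meson measurable_space)
  have "sigma_algebra (space M) ?I"
    unfolding sigma_algebra_iff2
  proof (intro conjI allI impI ballI)
    show "?I \<subseteq> Pow (space M)" using sets.sets_into_space by auto
    show "{} \<in> ?I" by simp
  next
    fix A assume A: "A \<in> ?I"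
    have "AE x in M. T g x \<in> space M - A \<longleftrightarrow> x \<in> space M - A" if g: "g \<in> carrier F" for g
    proof -
      have "AE x in M. T g x \<in> A \<longleftrightarrow> x \<in> A" using A g by blast
      then show ?thesis using AE_space by eventually_elim (use meas g in auto)
    qed
    then show "space M - A \<in> ?I" using A by auto
  next
    fix A :: "nat \<Rightarrow> 'x set" assume A: "range A \<subseteq> ?I"
    have "AE x in M. T g x \<in> (\<Union>i. A i) \<longleftrightarrow> x \<in> (\<Union>i. A i)" if g: "g \<in> carrier F" for g
    proof -
      have "AE x in M. \<forall>i. T g x \<in> A i \<longleftrightarrow> x \<in> A i"
        unfolding AE_all_countable using A g by blast
      then show ?thesis by eventually_elim auto
    qed
    moreover have "(\<Union>i. A i) \<in> sets M" using A by blast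
    ultimately show "(\<Union>i. A i) \<in> ?I" by blast
  qed
  then show ?thesis
    unfolding invariant_algebra_def by (rule sigma_algebra.sets_measure_of_eq)
qed

lemma strictly_invariant_version:
  assumes act: "pmp_action F M T" and grp: "group F" and "countable (carrier F)"
    and one: "\<And>x. x \<in> space M \<Longrightarrow> T \<one>\<^bsub>F\<^esub> x = x"
    and mult: "\<And>g h x. g \<in> carrier F \<Longrightarrow> h \<in> carrier F \<Longrightarrow> x \<in> space M \<Longrightarrow>
       T (g \<otimes>\<^bsub>F\<^esub> h) x = T g (T h x)"
    and A: "A \<in> sets (invariant_algebra F M T)"
  shows "\<exists>A'\<in>sets M. (\<forall>g\<in>carrier F. \<forall>x\<in>space M. T g x \<in> A' \<longleftrightarrow> x \<in> A') \<and>
           (AE x in M. x \<in> A \<longleftrightarrow> x \<in> A')"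
proof (intro bexI conjI ballI)
  define A' where "A' = {x \<in> space M. \<forall>g\<in>carrier F. T g x \<in> A}"
  interpret F: group F by (rule grp)
  have T: "T g \<in> measurable M M" if "g \<in> carrier F" for g
    using act that unfolding pmp_action_def by blast
  have AM: "A \<in> sets M" and inv: "\<forall>g\<in>carrier F. AE x in M. T g x \<in> A \<longleftrightarrow> x \<in> A"
    using A unfolding sets_invariant_algebra[OF act] by auto
  have "{x \<in> space M. T g x \<in> A} \<in> sets M" if "g \<in> carrier F" for g
    using measurable_sets[OF T[OF that] AM] by (simp add: vimage_def Int_def conj_commute)
  then show "A' \<in> sets M"
    unfolding A'_def using \<open>countable (carrier F)\<close> by (rule sets.sets_Collect_countable_All')
  have "AE x in M. \<forall>g\<in>carrier F. T g x \<in> A \<longleftrightarrow> x \<in> A"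
    using inv \<open>countable (carrier F)\<close> by (simp add: AE_ball_countable)
  then show "AE x in M. x \<in> A \<longleftrightarrow> x \<in> A'"
    using AE_space by eventually_elim (auto simp: A'_def intro: F.one_closed)
  fix g x assume g: "g \<in> carrier F" and x: "x \<in> space M"
  have Tx: "T g x \<in> space M" using T[OF g] x by (rule measurable_space)
  show "T g x \<in> A' \<longleftrightarrow> x \<in> A'"
  proof
    assume a: "T g x \<in> A'"
    have "T h x \<in> A" if h: "h \<in> carrier F" for h
    proof -
      have "T (h \<otimes>\<^bsub>F\<^esub> inv\<^bsub>F\<^esub> g) (T g x) = T h x"
        using mult[of "h \<otimes>\<^bsub>F\<^esub> inv\<^bsub>F\<^esub> g" g x] g h x by (simp add: F.m_assoc)
      then show ?thesis using a g h unfolding A'_def by (metis (mono_tags, lifting) F.inv_closed F.m_closed mem_Collect_eq)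
    qed
    then show "x \<in> A'" using x by (simp add: A'_def)
  next
    assume a: "x \<in> A'"
    have "T h (T g x) \<in> A" if h: "h \<in> carrier F" for h
      using a mult[OF h g x] g h unfolding A'_def by (metis (mono_tags, lifting) F.m_closed mem_Collect_eq)
    then show "T g x \<in> A'" using Tx by (simp add: A'_def)
  qed
qed

text \<open>Meaningful for \<open>n \<ge> 1\<close> only, as the empty sequence has no last vertex.\<close>

definition spherical_average ::
    "('g, 'm) monoid_scheme \<Rightarrow> 'v set \<Rightarrow> ('v \<Rightarrow> 'g) \<Rightarrow> ('v \<Rightarrow> 'v \<Rightarrow> real) \<Rightarrow> ('v \<Rightarrow> real) \<Rightarrow>
     ('g \<Rightarrow> 'x \<Rightarrow> 'x) \<Rightarrow> nat \<Rightarrow> ('x \<Rightarrow> real) \<Rightarrow> 'x \<Rightarrow> real" where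
  "spherical_average F V L P \<nu> T n \<phi> x =
     (\<Sum>s | set s \<subseteq> V \<and> length s = n. \<nu> (last s) * path_weight P s * \<phi> (T (path_label F L s) x))"

definition converges_in_L1 :: "'x measure \<Rightarrow> (nat \<Rightarrow> 'x \<Rightarrow> real) \<Rightarrow> ('x \<Rightarrow> real) \<Rightarrow> bool" where
  "converges_in_L1 M u h \<longleftrightarrow>
     (\<lambda>n. \<integral>\<^sup>+ x. ennreal \<bar>u n x - h x\<bar> \<partial>M) \<longlonglongrightarrow> 0"

end

theory Submission
  imports Defs
begin

text \<open>
  A good subgraph is obtained from a single path.  Inverting the vertices of a path and reading it
  backwards gives a path with the inverse label.  If \<open>p\<close> leads from \<open>v\<^sup>-\<^sup>1\<close> to \<open>u\<close>, its inverse \<open>q\<close>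
  leads from \<open>u\<^sup>-\<^sup>1\<close> to \<open>v\<close>, and the three given edges with their inverses are exactly what
  is needed for \<open>p\<close> and \<open>q\<close> to form a good subgraph in which each of them serves as the
  inverse of the other (\<open>good_subgraph_exists\<close>).

  For the convergence let \<open>a n v\<close> be the contribution to the spherical average of order \<open>n + 1\<close> of
  the sequences that end in \<open>v\<close>, with the factor \<open>\<nu> v\<close> removed.  Then
  \<open>a (n + 1) v x = (\<Sum>w\<in>V. P v w * a n w (T (L v) x))\<close>, so that \<open>a\<close> is an orbit of a Markov operator,
  a contraction of \<open>L\<^sup>2\<close> of the product of \<open>(V, \<nu>)\<close> with the probability space.  The norm lost in a
  step is a weighted sum of variances (\<open>energy_drop\<close>).  The norms converge, so the
  variances vanish in the limit, and asymptotically \<open>a (n + 1) v\<close> is \<open>a n w \<circ> T (L v)\<close> for each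
  edge from \<open>w\<close> to \<open>v\<close> (\<open>edge_asymptotic\<close>).  Thus a path of length \<open>m\<close> relates the functions at
  its ends at times that differ by \<open>m\<close>, and the paths of a good subgraph of order \<open>k\<close> fit
  together so that all labels cancel after \<open>2 * k\<close> steps: \<open>a (n + 2 * k) - a n\<close> tends to zero
  (\<open>good_subgraph_asymptotic_period\<close>).

  Hence averages \<open>b n\<close> over \<open>2 * k\<close> consecutive times form an orbit with \<open>b (n + 1) - b n\<close>
  tending to zero.  Such an orbit is a Cauchy sequence by the parallelogram law
  (\<open>asymptotically_fixed_energy_Cauchy\<close>).  Its limit \<open>h\<close> satisfies \<open>h v = h w \<circ> T (L v)\<close> along
  edges.  If the loops at some vertex generate the whole group, \<open>h\<close> is therefore an invariant
  function, the same at all vertices (\<open>fixed_is_invariant\<close>), and since the operator preserves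
  integrals over invariant sets, it is the conditional expectation.

  This is carried out for bounded functions.  The averages are contractions of \<open>L\<^sup>1\<close>, so density of
  bounded functions gives the result for all integrable functions.
\<close>

section \<open>Labelled paths and good subgraphs\<close>

lemma path_label_Nil [simp]: "path_label F L [] = \<one>\<^bsub>F\<^esub>"
  by (simp add: path_label_def)

lemma path_label_Cons [simp]: "path_label F L (v # s) = L v \<otimes>\<^bsub>F\<^esub> path_label F L s"
  by (simp add: path_label_def)

lemma (in monoid) path_label_closed:
  "L ` set s \<subseteq> carrier G \<Longrightarrow> path_label G L s \<in> carrier G"
  by (induction s) auto

lemma (in monoid) path_label_append:
  assumes "L ` set s \<subseteq> carrier G" "L ` set t \<subseteq> carrier G"
  shows "path_label G L (s @ t) = path_label G L s \<otimes> path_label G L t"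
  using assms by (induction s) (auto simp: path_label_closed m_assoc)

lemma (in group) path_label_rev_inverse:
  assumes "L ` set s \<subseteq> carrier G" "\<And>v. v \<in> set s \<Longrightarrow> L (r v) = inv L v"
  shows "path_label G L (rev (map r s)) = inv path_label G L s"
  using assms
proof (induction s)
  case (Cons v s)
  have "L ` r ` set s \<subseteq> carrier G" using Cons.prems by auto
  then have "path_label G L (rev (map r (v # s))) =
      path_label G L (rev (map r s)) \<otimes> path_label G L [r v]"
    using Cons.prems by (simp add: path_label_append)
  then show ?case using Cons by (simp add: inv_mult_group path_label_closed)
qed simp

lemma directed_path_Cons:
  "directed_path V E (v # s) \<longleftrightarrow>
     v \<in> V \<and> directed_path V E s \<and> (s \<noteq> [] \<longrightarrow> (v, hd s) \<in> E)"
  by (auto simp: directed_path_def successively_Cons)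

lemma directed_path_append:
  "directed_path V E (s @ t) \<longleftrightarrow>
     directed_path V E s \<and> directed_path V E t \<and> (s \<noteq> [] \<longrightarrow> t \<noteq> [] \<longrightarrow> (last s, hd t) \<in> E)"
  by (auto simp: directed_path_def successively_append_iff)

lemma directed_path_Nil [simp]: "directed_path V E []"
  by (simp add: directed_path_def)

lemma directed_path_of_rtrancl:
  assumes "(v, w) \<in> E\<^sup>*" "v \<in> V" "E \<subseteq> V \<times> V"
  shows "\<exists>s. directed_path V E s \<and> s \<noteq> [] \<and> hd s = v \<and> last s = w"
  using assms(1)
proof (induction rule: rtrancl_induct)
  case base
  show ?case using assms(2) by (intro exI[of _ "[v]"]) (simp add: directed_path_def)
next
  case (step x y)
  then obtain s where "directed_path V E s" "s \<noteq> []" "hd s = v" "last s = x" by blast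
  then show ?case using step assms(3)
    by (intro exI[of _ "s @ [y]"]) (auto simp: directed_path_append directed_path_Cons)
qed

lemma strongly_connected_path:
  assumes "strongly_connected V E" "E \<subseteq> V \<times> V" "v \<in> V" "w \<in> V"
  obtains s where "directed_path V E s" "s \<noteq> []" "hd s = v" "last s = w"
  using directed_path_of_rtrancl[of v w E V] assms unfolding strongly_connected_def by blast

text \<open>
  Inverting the vertices reverses the edges, so reading a path backwards with inverted vertices
  gives a path of the same length with the inverse label.  Take any path \<open>p\<close> from \<open>v\<^sup>-\<^sup>1\<close> to \<open>u\<close>
  and let \<open>q\<close> be its inverse, which goes from \<open>u\<^sup>-\<^sup>1\<close> to \<open>v\<close>.  The edge from \<open>u\<close> to \<open>v\<^sup>-\<^sup>1\<close> allows
  one to repeat \<open>p\<close>, its inverse edge allows one to repeat \<open>q\<close>, so \<open>q\<close> and \<open>p\<close> themselves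
  serve as \<open>p\<^sup>*\<close> and \<open>q\<^sup>*\<close>.  Both end in a predecessor of \<open>w\<close> and, by symmetry, both start in
  a successor of \<open>w\<^sup>-\<^sup>1\<close>.
\<close>

lemma (in group) good_subgraph_exists:
  assumes L: "L ` V \<subseteq> carrier G" and inj: "inj_on L V"
    and EV: "E \<subseteq> V \<times> V" and conn: "strongly_connected V E"
    and sym: "\<forall>(a, b)\<in>E. \<exists>a' b'.
      inverse_vertex G V L a a' \<and> inverse_vertex G V L b b' \<and> (b', a') \<in> E"
    and fork: "(v, w) \<in> E" "(u, w) \<in> E" "inverse_vertex G V L v v'" "(u, v') \<in> E"
  shows "\<exists>k\<ge>1. good_subgraph G V L E k"
proof -
  define r where "r a = (SOME a'. inverse_vertex G V L a a')" for a
  \<comment> \<open>Labels are injective, so the vertex with the inverse label is unique.\<close>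
  have unique: "r a = a'" if "inverse_vertex G V L a a'" for a a'
    using that inj unfolding r_def inverse_vertex_def inj_on_def by (metis (mono_tags, lifting) someI)
  have rE: "(r b, r a) \<in> E" if "(a, b) \<in> E" for a b
    using sym that unique by fastforce
  \<comment> \<open>Every vertex has an outgoing edge: \<open>v\<close> has one and can be reached from everywhere.\<close>
  have r_inverse: "inverse_vertex G V L a (r a)" if "a \<in> V" for a
  proof -
    have "v \<in> V" using fork EV by blast
    then have "(a, v) \<in> E\<^sup>*" using conn that by (auto simp: strongly_connected_def)
    then have "\<exists>b. (a, b) \<in> E" using fork by (metis converse_rtranclE)
    then show ?thesis using sym unique by fastforce
  qed
  have Lr: "L (r a) = inv L a" and rV: "r a \<in> V" if "a \<in> V" for a
    using r_inverse[OF that] by (auto simp: inverse_vertex_def)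
  have rr: "r (r a) = a" if "a \<in> V" for a
    using that L Lr rV by (intro unique) (auto simp: inverse_vertex_def)
  have V: "u \<in> V" "v \<in> V" "w \<in> V" "v' = r v"
    using fork EV unique by auto
  obtain p where p: "directed_path V E p" "p \<noteq> []" "hd p = r v" "last p = u"
    using strongly_connected_path[OF conn EV] V rV by metis
  define q where "q = rev (map r p)"
  have pV: "set p \<subseteq> V" using p by (simp add: directed_path_def)
  have q_path: "directed_path V E q"
    using p(1) rE rV unfolding q_def directed_path_def
    by (auto simp: successively_map elim!: successively_mono)
  have q: "q \<noteq> []" "hd q = r u" "last q = v" "length q = length p"
    using p V rr unfolding q_def by (auto simp: hd_rev last_rev hd_map last_map)
  have qV: "set q \<subseteq> V" using q_path by (simp add: directed_path_def)
  have labels: "path_label G L q = inv path_label G L p"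
    unfolding q_def using pV L Lr by (intro path_label_rev_inverse) auto
  have "path_label G L p \<in> carrier G"
    using pV L by (intro path_label_closed) auto
  then have labels': "path_label G L p = inv path_label G L q"
    using labels by simp
  have "(u, r v) \<in> E" "(v, r u) \<in> E" using fork V rE rr by metis+
  then have pqp: "directed_path V E (p @ p @ p)" "directed_path V E (q @ q @ q)"
    using p q q_path by (auto simp: directed_path_append)
  have "directed_path V E (r w # p @ [w])" "directed_path V E (r w # q @ [w])"
    using p q q_path V rV fork rE
    by (auto simp: directed_path_append directed_path_Cons)
  moreover have "1 \<le> length p" using p(2) by (cases p) auto
  ultimately show ?thesis
    unfolding good_subgraph_def
    using V(3) rV[OF V(3)] p(1) q(4) q_path pqp labels labels' by blast
qed

section \<open>Mean-square asymptotics of bounded functions\<close>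

text \<open>
  Bounded functions are dense in \<open>L\<^sup>1\<close> and closed under products.  They can be handled as elements
  of a Hilbert space without an integrability condition on squares.
\<close>

definition bounded_measurable :: "'x measure \<Rightarrow> ('x \<Rightarrow> real) set" where
  "bounded_measurable M = {f \<in> borel_measurable M. \<exists>C. \<forall>x\<in>space M. \<bar>f x\<bar> \<le> C}"

lemma bounded_measurableI:
  "f \<in> borel_measurable M \<Longrightarrow> (\<And>x. x \<in> space M \<Longrightarrow> \<bar>f x\<bar> \<le> C) \<Longrightarrow> f \<in> bounded_measurable M"
  by (auto simp: bounded_measurable_def)

lemma bounded_measurableE:
  assumes "f \<in> bounded_measurable M"
  obtains C where "0 \<le> C" "f \<in> borel_measurable M" "\<And>x. x \<in> space M \<Longrightarrow> \<bar>f x\<bar> \<le> C"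
proof -
  obtain C where "f \<in> borel_measurable M" "\<And>x. x \<in> space M \<Longrightarrow> \<bar>f x\<bar> \<le> C"
    using assms by (auto simp: bounded_measurable_def)
  then show ?thesis by (intro that[of "\<bar>C\<bar>"]) force+
qed

lemma bounded_measurable_borel [measurable_dest]:
  "f \<in> bounded_measurable M \<Longrightarrow> f \<in> borel_measurable M"
  by (simp add: bounded_measurable_def)

lemma bounded_measurable_const [simp, intro]: "(\<lambda>x. c) \<in> bounded_measurable M"
  by (rule bounded_measurableI[of _ _ "\<bar>c\<bar>"]) auto

lemma bounded_measurable_add [intro]:
  assumes "f \<in> bounded_measurable M" "g \<in> bounded_measurable M"
  shows "(\<lambda>x. f x + g x) \<in> bounded_measurable M"
proof -
  obtain C where C: "f \<in> borel_measurable M" "\<And>x. x \<in> space M \<Longrightarrow> \<bar>f x\<bar> \<le> C"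
    using bounded_measurableE[OF assms(1)] by blast
  obtain D where D: "g \<in> borel_measurable M" "\<And>x. x \<in> space M \<Longrightarrow> \<bar>g x\<bar> \<le> D"
    using bounded_measurableE[OF assms(2)] by blast
  have "\<bar>f x + g x\<bar> \<le> C + D" if "x \<in> space M" for x
    using C(2)[OF that] D(2)[OF that] by linarith
  then show ?thesis using C(1) D(1) by (intro bounded_measurableI[of _ _ "C + D"]) auto
qed

lemma bounded_measurable_mult [intro]:
  assumes "f \<in> bounded_measurable M" "g \<in> bounded_measurable M"
  shows "(\<lambda>x. f x * g x) \<in> bounded_measurable M"
proof -
  obtain C where C: "f \<in> borel_measurable M" "\<And>x. x \<in> space M \<Longrightarrow> \<bar>f x\<bar> \<le> C" "0 \<le> C"
    using bounded_measurableE[OF assms(1)] by blast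
  obtain D where D: "g \<in> borel_measurable M" "\<And>x. x \<in> space M \<Longrightarrow> \<bar>g x\<bar> \<le> D"
    using bounded_measurableE[OF assms(2)] by blast
  have "\<bar>f x * g x\<bar> \<le> C * D" if "x \<in> space M" for x
    unfolding abs_mult using C(2)[OF that] D(2)[OF that] C(3) by (rule mult_mono) simp
  then show ?thesis using C(1) D(1) by (intro bounded_measurableI[of _ _ "C * D"]) auto
qed

lemma bounded_measurable_diff [intro]:
  assumes "f \<in> bounded_measurable M" "g \<in> bounded_measurable M"
  shows "(\<lambda>x. f x - g x) \<in> bounded_measurable M"
  using bounded_measurable_add[OF assms(1) bounded_measurable_mult[OF _ assms(2), of "\<lambda>_. -1"]]
  by simp

lemma bounded_measurable_power [intro]:
  "f \<in> bounded_measurable M \<Longrightarrow> (\<lambda>x. f x ^ n) \<in> bounded_measurable M"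
  by (induction n) auto

lemma bounded_measurable_sum [intro]:
  "(\<And>i. i \<in> I \<Longrightarrow> f i \<in> bounded_measurable M) \<Longrightarrow> (\<lambda>x. \<Sum>i\<in>I. f i x) \<in> bounded_measurable M"
  by (induction I rule: infinite_finite_induct) auto

lemma bounded_measurable_compose:
  assumes "f \<in> bounded_measurable M" "h \<in> measurable M M"
  shows "(\<lambda>x. f (h x)) \<in> bounded_measurable M"
  using assms measurable_space[OF assms(2)]
  by (auto simp: bounded_measurable_def intro: measurable_compose)

context prob_space
begin

lemma bounded_measurable_integrable:
  assumes "f \<in> bounded_measurable M" shows "integrable M f"
proof -
  obtain C where C: "f \<in> borel_measurable M" "\<And>x. x \<in> space M \<Longrightarrow> \<bar>f x\<bar> \<le> C"
    using bounded_measurableE[OF assms] by blast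
  show ?thesis by (rule integrable_const_bound[of _ C]) (use C in auto)
qed

definition mean_square :: "('a \<Rightarrow> real) \<Rightarrow> real" where
  "mean_square f = (\<integral>x. (f x)\<^sup>2 \<partial>M)"

lemma mean_square_nonneg: "0 \<le> mean_square f"
  by (simp add: mean_square_def)

lemma mean_square_cong_AE:
  assumes "f \<in> borel_measurable M" "g \<in> borel_measurable M" "AE x in M. f x = g x"
  shows "mean_square f = mean_square g"
  unfolding mean_square_def by (rule integral_cong_AE) (use assms in auto)

lemma mean_square_minus: "mean_square (\<lambda>x. f x - g x) = mean_square (\<lambda>x. g x - f x)"
  by (simp add: mean_square_def power2_commute)

lemma parallelogram:
  assumes "f \<in> bounded_measurable M" "g \<in> bounded_measurable M"
  shows "mean_square (\<lambda>x. f x + g x) + mean_square (\<lambda>x. f x - g x) =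
    2 * mean_square f + 2 * mean_square g"
proof -
  have [intro]: "(\<lambda>x. (f x + g x)\<^sup>2) \<in> bounded_measurable M" "(\<lambda>x. (f x - g x)\<^sup>2) \<in> bounded_measurable M"
    "(\<lambda>x. (f x)\<^sup>2) \<in> bounded_measurable M" "(\<lambda>x. (g x)\<^sup>2) \<in> bounded_measurable M"
    using assms by auto
  have "mean_square (\<lambda>x. f x + g x) + mean_square (\<lambda>x. f x - g x) =
      (\<integral>x. (f x + g x)\<^sup>2 + (f x - g x)\<^sup>2 \<partial>M)"
    unfolding mean_square_def by (rule Bochner_Integration.integral_add[symmetric]) (auto intro: bounded_measurable_integrable)
  also have "\<dots> = (\<integral>x. 2 * (f x)\<^sup>2 + 2 * (g x)\<^sup>2 \<partial>M)"
    by (simp add: power2_eq_square algebra_simps)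
  also have "\<dots> = 2 * mean_square f + 2 * mean_square g"
    unfolding mean_square_def
    by (subst Bochner_Integration.integral_add) (auto intro!: bounded_measurable_integrable)
  finally show ?thesis .
qed

lemma mean_square_add_le:
  assumes "f \<in> bounded_measurable M" "g \<in> bounded_measurable M"
  shows "mean_square (\<lambda>x. f x + g x) \<le> 2 * mean_square f + 2 * mean_square g"
  using parallelogram[OF assms] mean_square_nonneg[of "\<lambda>x. f x - g x"] by linarith

lemma mean_square_cmult: "mean_square (\<lambda>x. c * f x) = c\<^sup>2 * mean_square f"
  by (simp add: mean_square_def power_mult_distrib)

text \<open>
  The bound \<open>\<bar>t\<bar> \<le> e / 2 + t\<^sup>2 / (2 * e)\<close> of a real number by its square makes mean-square
  convergence stronger than convergence in mean.
\<close>

lemma abs_integral_le_mean_square: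
  assumes "f \<in> bounded_measurable M" "0 < e" "mean_square f < e\<^sup>2"
  shows "(\<integral>x. \<bar>f x\<bar> \<partial>M) < e"
proof -
  have le: "\<bar>f x\<bar> \<le> e / 2 + 1 / (2 * e) * (f x)\<^sup>2" for x
  proof -
    have "0 \<le> (\<bar>f x\<bar> - e)\<^sup>2" by simp
    then have "2 * e * \<bar>f x\<bar> \<le> e\<^sup>2 + (f x)\<^sup>2" by (simp add: power2_eq_square algebra_simps)
    then show ?thesis using assms(2) by (simp add: field_simps power2_eq_square)
  qed
  have int: "integrable M (\<lambda>x. \<bar>f x\<bar>)" "integrable M (\<lambda>x. 1 / (2 * e) * (f x)\<^sup>2)"
    by (intro integrable_abs integrable_mult_right bounded_measurable_integrable
        bounded_measurable_power assms(1))+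
  have "(\<integral>x. \<bar>f x\<bar> \<partial>M) \<le> (\<integral>x. e / 2 + 1 / (2 * e) * (f x)\<^sup>2 \<partial>M)"
    by (rule integral_mono) (use int le in auto)
  also have "\<dots> = e / 2 + 1 / (2 * e) * mean_square f"
    unfolding mean_square_def
    by (subst Bochner_Integration.integral_add) (use int in \<open>auto simp: prob_space\<close>)
  also have "\<dots> < e / 2 + 1 / (2 * e) * e\<^sup>2"
    using assms(2,3) by (intro add_strict_left_mono mult_strict_left_mono) auto
  also have "\<dots> = e" using assms(2) by (simp add: field_simps power2_eq_square)
  finally show ?thesis .
qed

definition asymptotic :: "(nat \<Rightarrow> 'a \<Rightarrow> real) \<Rightarrow> (nat \<Rightarrow> 'a \<Rightarrow> real) \<Rightarrow> bool" (infix "\<simeq>" 50) where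
  "f \<simeq> g \<longleftrightarrow> (\<forall>n. f n \<in> bounded_measurable M) \<and> (\<forall>n. g n \<in> bounded_measurable M) \<and>
     (\<lambda>n. mean_square (\<lambda>x. f n x - g n x)) \<longlonglongrightarrow> 0"

lemma asymptotic_sym: "f \<simeq> g \<Longrightarrow> g \<simeq> f"
  unfolding asymptotic_def by (subst mean_square_minus) simp

lemma asymptotic_trans [trans]:
  assumes fg: "f \<simeq> g" and gh: "g \<simeq> h" shows "f \<simeq> h"
proof -
  let ?B = "\<lambda>n. 2 * mean_square (\<lambda>x. f n x - g n x) + 2 * mean_square (\<lambda>x. g n x - h n x)"
  have bm: "f n \<in> bounded_measurable M" "g n \<in> bounded_measurable M" "h n \<in> bounded_measurable M" for n
    using fg gh unfolding asymptotic_def by simp_all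
  have le: "mean_square (\<lambda>x. f n x - h n x) \<le> ?B n" for n
    using mean_square_add_le[of "\<lambda>x. f n x - g n x" "\<lambda>x. g n x - h n x"]
      bounded_measurable_diff[OF bm(1,2)] bounded_measurable_diff[OF bm(2,3)] by simp
  have "?B \<longlonglongrightarrow> 2 * 0 + 2 * 0"
    using fg gh unfolding asymptotic_def by (intro tendsto_intros) simp_all
  then have lim: "?B \<longlonglongrightarrow> 0" by simp
  have "(\<lambda>n. mean_square (\<lambda>x. f n x - h n x)) \<longlonglongrightarrow> 0"
    by (rule tendsto_sandwich[OF always_eventually always_eventually tendsto_const lim])
      (use le mean_square_nonneg in auto)
  then show ?thesis using bm unfolding asymptotic_def by blast
qed

lemma asymptotic_AE:
  assumes "\<And>n. f n \<in> bounded_measurable M" "\<And>n. g n \<in> bounded_measurable M"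
    and "\<And>n. AE x in M. f n x = g n x"
  shows "f \<simeq> g"
proof -
  have "mean_square (\<lambda>x. f n x - g n x) = mean_square (\<lambda>x. 0)" for n
    using assms(3)[of n] assms(1,2) by (intro mean_square_cong_AE) auto
  then show ?thesis using assms by (simp add: asymptotic_def mean_square_def)
qed

lemma asymptotic_shift: "f \<simeq> g \<Longrightarrow> (\<lambda>n. f (n + k)) \<simeq> (\<lambda>n. g (n + k))"
  unfolding asymptotic_def by (auto intro: LIMSEQ_ignore_initial_segment)

lemma asymptotic_unshift:
  assumes "(\<lambda>n. f (n + k)) \<simeq> (\<lambda>n. g (n + k))"
    and "\<And>n. f n \<in> bounded_measurable M" "\<And>n. g n \<in> bounded_measurable M"
  shows "f \<simeq> g"
  using assms unfolding asymptotic_def by (auto intro: LIMSEQ_offset[of _ k])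

lemma mean_square_compose:
  assumes "h \<in> measurable M M" "distr M M h = M" "f \<in> borel_measurable M"
  shows "mean_square (\<lambda>x. f (h x)) = mean_square f"
  unfolding mean_square_def
  using integral_distr[OF assms(1), of "\<lambda>x. (f x)\<^sup>2"] assms(2,3) by simp

lemma asymptotic_compose:
  assumes h: "h \<in> measurable M M" "distr M M h = M"
    and "\<And>n. f n \<in> bounded_measurable M" "\<And>n. g n \<in> bounded_measurable M"
  shows "(\<lambda>n x. f n (h x)) \<simeq> (\<lambda>n x. g n (h x)) \<longleftrightarrow> f \<simeq> g"
proof -
  have "mean_square (\<lambda>x. f n (h x) - g n (h x)) = mean_square (\<lambda>x. f n x - g n x)" for n
    using assms by (intro mean_square_compose) (auto intro!: bounded_measurable_borel)
  moreover have "(\<lambda>x. f n (h x)) \<in> bounded_measurable M" "(\<lambda>x. g n (h x)) \<in> bounded_measurable M" for n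
    by (rule bounded_measurable_compose[OF assms(3) h(1)] bounded_measurable_compose[OF assms(4) h(1)])+
  ultimately show ?thesis using assms(3,4) by (simp add: asymptotic_def)
qed

text \<open>
  Completeness of \<open>L\<^sup>1\<close>: a subsequence converges almost everywhere, and Fatou's lemma
  applied to \<open>\<bar>u n - u (r i)\<bar>\<close> bounds the distance of \<open>u n\<close> to its limit.
\<close>

lemma L1_Cauchy_converges:
  fixes u :: "nat \<Rightarrow> 'a \<Rightarrow> real"
  assumes int: "\<And>n. integrable M (u n)"
    and Cauchy: "\<And>e. e > 0 \<Longrightarrow> \<exists>N. \<forall>i\<ge>N. \<forall>j\<ge>N. (\<integral>x. \<bar>u i x - u j x\<bar> \<partial>M) < e"
  obtains h where "integrable M h" "(\<lambda>n. \<integral>x. \<bar>u n x - h x\<bar> \<partial>M) \<longlonglongrightarrow> 0"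
proof -
  obtain r where r: "strict_mono r" "AE x in M. Cauchy (\<lambda>i. u (r i) x)"
    by (rule cauchy_L1_AE_cauchy_subseq[of M u, OF int, unfolded real_norm_def, OF Cauchy])
  define h where "h x = lim (\<lambda>i. u (r i) x)" for x
  have [measurable]: "u n \<in> borel_measurable M" for n using int by auto
  have h [measurable]: "h \<in> borel_measurable M" unfolding h_def by measurable
  have lim: "AE x in M. (\<lambda>i. u (r i) x) \<longlonglongrightarrow> h x"
    using r(2) by eventually_elim (simp add: h_def Cauchy_convergent_iff convergent_LIMSEQ_iff)
  have bound: "(\<integral>\<^sup>+x. ennreal \<bar>u n x - h x\<bar> \<partial>M) \<le> ennreal e"
    if "0 < e" and less_e: "\<And>i j. i \<ge> N \<Longrightarrow> j \<ge> N \<Longrightarrow> (\<integral>x. \<bar>u i x - u j x\<bar> \<partial>M) < e" and "n \<ge> N" for e N n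
  proof -
    have "AE x in M. ennreal \<bar>u n x - h x\<bar> = liminf (\<lambda>i. ennreal \<bar>u n x - u (r i) x\<bar>)"
      using lim
    proof eventually_elim
      case (elim x)
      then have "(\<lambda>i. ennreal \<bar>u n x - u (r i) x\<bar>) \<longlonglongrightarrow> ennreal \<bar>u n x - h x\<bar>"
        by (intro tendsto_intros)
      then show ?case by (rule lim_imp_Liminf[OF trivial_limit_sequentially, symmetric])
    qed
    then have "(\<integral>\<^sup>+x. ennreal \<bar>u n x - h x\<bar> \<partial>M) =
        (\<integral>\<^sup>+x. liminf (\<lambda>i. ennreal \<bar>u n x - u (r i) x\<bar>) \<partial>M)"
      by (rule nn_integral_cong_AE)
    also have "\<dots> \<le> liminf (\<lambda>i. \<integral>\<^sup>+x. ennreal \<bar>u n x - u (r i) x\<bar> \<partial>M)"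
      by (rule nn_integral_liminf) measurable
    also have "\<dots> \<le> liminf (\<lambda>i. ennreal e)"
    proof (rule Liminf_mono)
      have "(\<integral>\<^sup>+x. ennreal \<bar>u n x - u (r i) x\<bar> \<partial>M) \<le> ennreal e" if "i \<ge> N" for i
      proof -
        have "r i \<ge> N" using that seq_suble[OF r(1), of i] by linarith
        then have "(\<integral>x. \<bar>u n x - u (r i) x\<bar> \<partial>M) \<le> e" using less_e[OF \<open>n \<ge> N\<close>, of "r i"] by simp
        then show ?thesis using int by (subst nn_integral_eq_integral) (auto intro: ennreal_leI)
      qed
      then show "\<forall>\<^sub>F i in sequentially. (\<integral>\<^sup>+x. ennreal \<bar>u n x - u (r i) x\<bar> \<partial>M) \<le> ennreal e"
        by (auto simp: eventually_sequentially)
    qed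
    also have "\<dots> = ennreal e" by (simp add: Liminf_const)
    finally show ?thesis .
  qed
  obtain N where N: "\<And>i j. i \<ge> N \<Longrightarrow> j \<ge> N \<Longrightarrow> (\<integral>x. \<bar>u i x - u j x\<bar> \<partial>M) < 1"
    using Cauchy[of 1] by auto
  have diff: "integrable M (\<lambda>x. u N x - h x)"
  proof (rule integrableI_bounded)
    have "(\<integral>\<^sup>+x. ennreal \<bar>u N x - h x\<bar> \<partial>M) \<le> ennreal 1"
      by (rule bound[of 1 N N]) (use N in auto)
    also have "\<dots> < \<infinity>" by simp
    finally show "(\<integral>\<^sup>+x. ennreal (norm (u N x - h x)) \<partial>M) < \<infinity>" by simp
  qed measurable
  have "integrable M h"
    using Bochner_Integration.integrable_diff[OF int[of N] diff] by simp
  moreover have "(\<lambda>n. \<integral>x. \<bar>u n x - h x\<bar> \<partial>M) \<longlonglongrightarrow> 0"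
  proof (rule LIMSEQ_I)
    fix e :: real assume "0 < e"
    then obtain N where N: "\<And>i j. i \<ge> N \<Longrightarrow> j \<ge> N \<Longrightarrow> (\<integral>x. \<bar>u i x - u j x\<bar> \<partial>M) < e / 2"
      using Cauchy[of "e / 2"] by auto
    have "(\<integral>x. \<bar>u n x - h x\<bar> \<partial>M) \<le> e / 2" if "n \<ge> N" for n
      using bound[of "e / 2" N n] N that \<open>0 < e\<close> int \<open>integrable M h\<close>
      by (subst (asm) nn_integral_eq_integral) auto
    then show "\<exists>N. \<forall>n\<ge>N. norm ((\<integral>x. \<bar>u n x - h x\<bar> \<partial>M) - 0) < e"
      using \<open>0 < e\<close> by (intro exI[of _ N]) fastforce
  qed
  ultimately show ?thesis by (rule that)
qed

end

section \<open>Orbits of the Markov operator\<close>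

locale markov_action = group F + prob_space M
  for F :: "('g, 'm) monoid_scheme" (structure) and M :: "'x measure" +
  fixes V :: "'v set" and L :: "'v \<Rightarrow> 'g" and P :: "'v \<Rightarrow> 'v \<Rightarrow> real"
    and \<nu> :: "'v \<Rightarrow> real" and T :: "'g \<Rightarrow> 'x \<Rightarrow> 'x"
  assumes finite_V: "finite V"
    and L_closed: "L ` V \<subseteq> carrier F"
    and stochastic: "stochastic V P"
    and stationary: "stationary_distribution V P \<nu>"
    and positive: "\<And>v. v \<in> V \<Longrightarrow> 0 < \<nu> v"
    and action: "pmp_action F M T"
begin

abbreviation "E \<equiv> edges V P"

lemma T_measurable [measurable]: "g \<in> carrier F \<Longrightarrow> T g \<in> measurable M M"
  and T_distr: "g \<in> carrier F \<Longrightarrow> distr M M (T g) = M"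
  and T_one: "AE x in M. T \<one> x = x"
  and T_mult: "g \<in> carrier F \<Longrightarrow> h \<in> carrier F \<Longrightarrow> AE x in M. T (g \<otimes> h) x = T g (T h x)"
  using action by (auto simp: pmp_action_def)

lemma AE_T:
  assumes "g \<in> carrier F" "AE x in M. Q x"
  shows "AE x in M. Q (T g x)"
  using AE_distrD[OF T_measurable[OF assms(1)], of Q] assms(2) unfolding T_distr[OF assms(1)] by blast

lemma bounded_T:
  "f \<in> bounded_measurable M \<Longrightarrow> g \<in> carrier F \<Longrightarrow> (\<lambda>x. f (T g x)) \<in> bounded_measurable M"
  by (rule bounded_measurable_compose[OF _ T_measurable])

lemma integral_T:
  fixes f :: "'x \<Rightarrow> real"
  assumes "g \<in> carrier F" "f \<in> borel_measurable M"
  shows "(\<integral>x. f (T g x) \<partial>M) = (\<integral>x. f x \<partial>M)"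
  using integral_distr[OF T_measurable[OF assms(1)] assms(2)] T_distr[OF assms(1)] by simp

lemma integrable_T:
  fixes f :: "'x \<Rightarrow> real"
  assumes "integrable M f" "g \<in> carrier F"
  shows "integrable M (\<lambda>x. f (T g x))"
  using integrable_distr[OF T_measurable[OF assms(2)], of f] assms T_distr by simp

lemma mean_square_T:
  "g \<in> carrier F \<Longrightarrow> f \<in> borel_measurable M \<Longrightarrow> mean_square (\<lambda>x. f (T g x)) = mean_square f"
  by (rule mean_square_compose[OF T_measurable T_distr])

lemma L_in [simp]: "v \<in> V \<Longrightarrow> L v \<in> carrier F"
  using L_closed by auto

lemma P_nonneg: "v \<in> V \<Longrightarrow> w \<in> V \<Longrightarrow> 0 \<le> P v w"
  and P_sum: "v \<in> V \<Longrightarrow> (\<Sum>w\<in>V. P v w) = 1"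
  and \<nu>_nonneg: "v \<in> V \<Longrightarrow> 0 \<le> \<nu> v"
  and \<nu>_sum: "(\<Sum>v\<in>V. \<nu> v) = 1"
  and \<nu>_stationary: "w \<in> V \<Longrightarrow> (\<Sum>v\<in>V. \<nu> v * P v w) = \<nu> w"
  using stochastic stationary by (auto simp: stochastic_def stationary_distribution_def)

lemma path_label_in: "set s \<subseteq> V \<Longrightarrow> path_label F L s \<in> carrier F"
  using L_closed by (intro path_label_closed) auto

lemma path_label_append_V:
  "set s \<subseteq> V \<Longrightarrow> set t \<subseteq> V \<Longrightarrow> path_label F L (s @ t) = path_label F L s \<otimes> path_label F L t"
  using L_closed by (intro path_label_append) auto

text \<open>
  An orbit of the Markov operator \<open>a \<mapsto> (\<lambda>v x. \<Sum>w. P v w * a w (T (L v) x))\<close>.  The recursion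
  holds almost everywhere only, like the composition law of the action, and in exchange
  the functions may be given by any convenient formula.
\<close>

definition orbit :: "(nat \<Rightarrow> 'v \<Rightarrow> 'x \<Rightarrow> real) \<Rightarrow> bool" where
  "orbit a \<longleftrightarrow> (\<forall>n. \<forall>v\<in>V. a n v \<in> bounded_measurable M) \<and>
     (\<forall>n. \<forall>v\<in>V. AE x in M. a (Suc n) v x = (\<Sum>w\<in>V. P v w * a n w (T (L v) x)))"

lemma orbit_bounded: "orbit a \<Longrightarrow> v \<in> V \<Longrightarrow> a n v \<in> bounded_measurable M"
  and orbit_Suc:
    "orbit a \<Longrightarrow> v \<in> V \<Longrightarrow> AE x in M. a (Suc n) v x = (\<Sum>w\<in>V. P v w * a n w (T (L v) x))"
  by (auto simp: orbit_def)

lemma orbit_shift: "orbit a \<Longrightarrow> orbit (\<lambda>n. a (n + k))"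
  by (simp add: orbit_def)

lemma orbit_cmult:
  assumes "orbit a" shows "orbit (\<lambda>n v x. c * a n v x)"
  unfolding orbit_def
proof (intro conjI allI ballI)
  fix n v assume v: "v \<in> V"
  show "(\<lambda>x. c * a n v x) \<in> bounded_measurable M"
    by (intro bounded_measurable_mult bounded_measurable_const orbit_bounded[OF assms v])
  show "AE x in M. c * a (Suc n) v x = (\<Sum>w\<in>V. P v w * (c * a n w (T (L v) x)))"
    using orbit_Suc[OF assms v, of n] by eventually_elim (simp add: sum_distrib_left mult_ac)
qed

lemma orbit_add:
  assumes "orbit a" "orbit b" shows "orbit (\<lambda>n v x. a n v x + b n v x)"
  unfolding orbit_def
proof (intro conjI allI ballI)
  fix n v assume v: "v \<in> V"
  show "(\<lambda>x. a n v x + b n v x) \<in> bounded_measurable M"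
    by (intro bounded_measurable_add orbit_bounded assms v)
  show "AE x in M. a (Suc n) v x + b (Suc n) v x = (\<Sum>w\<in>V. P v w * (a n w (T (L v) x) + b n w (T (L v) x)))"
    using orbit_Suc[OF assms(1) v, of n] orbit_Suc[OF assms(2) v, of n]
    by eventually_elim (simp add: sum.distrib distrib_left)
qed

lemma orbit_sum:
  fixes k :: nat
  assumes "\<And>i. i < k \<Longrightarrow> orbit (a i)" shows "orbit (\<lambda>n v x. \<Sum>i<k. a i n v x)"
  using assms
proof (induction k)
  case 0
  show ?case by (simp add: orbit_def)
next
  case (Suc k)
  then show ?case using orbit_add[of "\<lambda>n v x. \<Sum>i<k. a i n v x" "a k"] by simp
qed

section \<open>Energy and the asymptotics along edges and paths\<close>

text \<open>
  The squared norm in \<open>L\<^sup>2\<close> of the product of \<open>(V, \<nu>)\<close> with the probability space.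
\<close>

definition energy :: "('v \<Rightarrow> 'x \<Rightarrow> real) \<Rightarrow> real" where
  "energy a = (\<Sum>v\<in>V. \<nu> v * mean_square (a v))"

lemma energy_nonneg: "0 \<le> energy a"
  unfolding energy_def by (intro sum_nonneg mult_nonneg_nonneg \<nu>_nonneg mean_square_nonneg)

lemma weighted_mean_square_le_energy: "\<nu> v * mean_square (a v) \<le> energy a" if "v \<in> V"
  unfolding energy_def using that finite_V
  by (intro member_le_sum mult_nonneg_nonneg \<nu>_nonneg mean_square_nonneg) auto

text \<open>
  A convex combination of vectors is shorter than they are on average, and the defect is their
  variance.
\<close>

lemma mean_square_variance:
  assumes a: "\<And>w. w \<in> V \<Longrightarrow> a w \<in> bounded_measurable M" and v: "v \<in> V"
  defines "m \<equiv> \<lambda>x. \<Sum>w\<in>V. P v w * a w x"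
  shows "(\<Sum>w\<in>V. P v w * mean_square (\<lambda>x. a w x - m x)) =
    (\<Sum>w\<in>V. P v w * mean_square (a w)) - mean_square m"
proof -
  have m: "m \<in> bounded_measurable M"
    unfolding m_def by (intro bounded_measurable_sum bounded_measurable_mult bounded_measurable_const a)
  have int: "integrable M (\<lambda>x. P v w * (a w x)\<^sup>2)" "integrable M (\<lambda>x. P v w * (a w x - m x)\<^sup>2)"
    if "w \<in> V" for w
    using a[OF that] m
    by (auto intro!: bounded_measurable_integrable bounded_measurable_mult bounded_measurable_power bounded_measurable_diff)
  have int_m: "integrable M (\<lambda>x. (m x)\<^sup>2)"
    using m by (auto intro!: bounded_measurable_integrable)
  have pt: "(\<Sum>w\<in>V. P v w * (a w x - m x)\<^sup>2) = (\<Sum>w\<in>V. P v w * (a w x)\<^sup>2) - (m x)\<^sup>2" for x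
  proof -
    have "(\<Sum>w\<in>V. P v w * (a w x - m x)\<^sup>2) =
        (\<Sum>w\<in>V. P v w * (a w x)\<^sup>2 - 2 * m x * (P v w * a w x) + (m x)\<^sup>2 * P v w)"
      by (intro sum.cong) (auto simp: power2_eq_square algebra_simps)
    also have "\<dots> = (\<Sum>w\<in>V. P v w * (a w x)\<^sup>2) - 2 * m x * m x + (m x)\<^sup>2"
      by (simp add: sum.distrib sum_subtractf sum_distrib_left[symmetric] P_sum[OF v] m_def)
    finally show ?thesis by (simp add: power2_eq_square)
  qed
  have "(\<Sum>w\<in>V. P v w * mean_square (\<lambda>x. a w x - m x)) =
      (\<integral>x. (\<Sum>w\<in>V. P v w * (a w x - m x)\<^sup>2) \<partial>M)"
    unfolding mean_square_def using int by (subst Bochner_Integration.integral_sum) auto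
  also have "\<dots> = (\<integral>x. (\<Sum>w\<in>V. P v w * (a w x)\<^sup>2) - (m x)\<^sup>2 \<partial>M)"
    by (simp add: pt)
  also have "\<dots> = (\<Sum>w\<in>V. P v w * mean_square (a w)) - mean_square m"
    unfolding mean_square_def using int int_m
    by (subst Bochner_Integration.integral_diff, force, force, subst Bochner_Integration.integral_sum) auto
  finally show ?thesis .
qed

text \<open>
  By stationarity the energy is the \<open>\<nu>\<close>-average over \<open>v\<close> of the \<open>P v\<close>-averages of the squared
  norms.  A step replaces each \<open>P v\<close>-average by the squared norm of the mean, moved by the
  isometry \<open>T (L v)\<close>, so that it loses exactly the variances.
\<close>

lemma energy_drop:
  assumes "orbit a"
  defines "m \<equiv> \<lambda>n v x. \<Sum>w\<in>V. P v w * a n w x"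
  shows "energy (a n) - energy (a (Suc n)) =
    (\<Sum>v\<in>V. \<nu> v * (\<Sum>w\<in>V. P v w * mean_square (\<lambda>x. a n w x - m n v x)))"
proof -
  have a: "a n v \<in> bounded_measurable M" if "v \<in> V" for n v
    using orbit_bounded[OF assms(1) that] .
  have m: "m n v \<in> bounded_measurable M" for n v
    unfolding m_def by (intro bounded_measurable_sum bounded_measurable_mult bounded_measurable_const a)
  have "energy (a n) = (\<Sum>w\<in>V. (\<Sum>v\<in>V. \<nu> v * P v w) * mean_square (a n w))"
    unfolding energy_def by (intro sum.cong) (auto simp: \<nu>_stationary)
  also have "\<dots> = (\<Sum>w\<in>V. \<Sum>v\<in>V. \<nu> v * (P v w * mean_square (a n w)))"
    by (simp only: sum_distrib_right mult.assoc)
  also have "\<dots> = (\<Sum>v\<in>V. \<nu> v * (\<Sum>w\<in>V. P v w * mean_square (a n w)))"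
    by (subst sum.swap) (simp add: sum_distrib_left)
  finally have before: "energy (a n) = (\<Sum>v\<in>V. \<nu> v * (\<Sum>w\<in>V. P v w * mean_square (a n w)))" .
  have "mean_square (a (Suc n) v) = mean_square (m n v)" if v: "v \<in> V" for v
  proof -
    have "mean_square (a (Suc n) v) = mean_square (\<lambda>x. m n v (T (L v) x))"
      using orbit_Suc[OF assms(1) v, of n] a[OF v] bounded_T[OF m L_in[OF v]]
      by (intro mean_square_cong_AE) (auto simp: m_def dest: bounded_measurable_borel)
    also have "\<dots> = mean_square (m n v)"
      using m v by (intro mean_square_T) (auto dest: bounded_measurable_borel)
    finally show ?thesis .
  qed
  then have "energy (a (Suc n)) = (\<Sum>v\<in>V. \<nu> v * mean_square (m n v))"
    unfolding energy_def by (intro sum.cong) auto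
  then show ?thesis
    unfolding before using mean_square_variance[of "a n", OF a]
    by (simp add: m_def sum_subtractf[symmetric] right_diff_distrib[symmetric])
qed

lemma energy_Suc_le: "orbit a \<Longrightarrow> energy (a (Suc n)) \<le> energy (a n)"
  using energy_drop[of a n]
  by (smt (verit, best) P_nonneg \<nu>_nonneg mean_square_nonneg mult_nonneg_nonneg sum_nonneg)

lemma energy_decseq: "orbit a \<Longrightarrow> decseq (\<lambda>n. energy (a n))"
  by (intro decseq_SucI energy_Suc_le)

lemma energy_convergent:
  assumes "orbit a" obtains q where "(\<lambda>n. energy (a n)) \<longlonglongrightarrow> q" "\<And>n. q \<le> energy (a n)"
  using decseq_convergent[OF energy_decseq[OF assms], of 0] energy_nonneg by metis

lemma edgesD: "(w, v) \<in> E \<Longrightarrow> w \<in> V" "(w, v) \<in> E \<Longrightarrow> v \<in> V" "(w, v) \<in> E \<Longrightarrow> 0 < P v w"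
  by (auto simp: edges_def)

lemma asymptotic_T_mult:
  assumes "\<And>n. f n \<in> bounded_measurable M" "g \<in> carrier F" "h \<in> carrier F"
  shows "(\<lambda>n x. f n (T (g \<otimes> h) x)) \<simeq> (\<lambda>n x. f n (T g (T h x)))"
proof (rule asymptotic_AE)
  fix n
  show "(\<lambda>x. f n (T (g \<otimes> h) x)) \<in> bounded_measurable M"
    using assms by (intro bounded_T) auto
  show "(\<lambda>x. f n (T g (T h x))) \<in> bounded_measurable M"
    using bounded_T[OF bounded_T[OF assms(1,2)] assms(3)] .
  show "AE x in M. f n (T (g \<otimes> h) x) = f n (T g (T h x))"
    using T_mult[OF assms(2,3)] by eventually_elim simp
qed

lemma asymptotic_T:
  assumes "f \<simeq> f'" "g \<in> carrier F"
  shows "(\<lambda>n x. f n (T g x)) \<simeq> (\<lambda>n x. f' n (T g x))"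
  using assms asymptotic_compose[OF T_measurable[OF assms(2)] T_distr[OF assms(2)]]
  by (simp add: asymptotic_def)

text \<open>
  The energies decrease to a limit, so the energy lost in a step tends to zero.  The loss
  dominates \<open>\<nu> v * P v w\<close> times the squared distance of \<open>a n w\<close> to the \<open>P v\<close>-mean that is
  transported to \<open>a (Suc n) v\<close>.  Along an edge this factor is positive.
\<close>

lemma edge_asymptotic:
  assumes a: "orbit a" and wv: "(w, v) \<in> E"
  shows "(\<lambda>n. a (Suc n) v) \<simeq> (\<lambda>n x. a n w (T (L v) x))"
proof -
  note V = edgesD(1,2)[OF wv]
  define m where "m n v x = (\<Sum>w\<in>V. P v w * a n w x)" for n v x
  have m: "m n v \<in> bounded_measurable M" for n
    unfolding m_def
    by (intro bounded_measurable_sum bounded_measurable_mult bounded_measurable_const orbit_bounded[OF a])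
  have pos: "0 < \<nu> v * P v w" using positive[OF V(2)] edgesD(3)[OF wv] by simp
  have le: "mean_square (\<lambda>x. a (Suc n) v x - a n w (T (L v) x)) \<le>
      (energy (a n) - energy (a (Suc n))) / (\<nu> v * P v w)" for n
  proof -
    have "mean_square (\<lambda>x. a (Suc n) v x - a n w (T (L v) x)) =
        mean_square (\<lambda>x. m n v (T (L v) x) - a n w (T (L v) x))"
    proof (rule mean_square_cong_AE)
      show "(\<lambda>x. a (Suc n) v x - a n w (T (L v) x)) \<in> borel_measurable M"
        "(\<lambda>x. m n v (T (L v) x) - a n w (T (L v) x)) \<in> borel_measurable M"
        by (intro bounded_measurable_borel bounded_measurable_diff bounded_T orbit_bounded[OF a] V m L_in)+
      show "AE x in M. a (Suc n) v x - a n w (T (L v) x) = m n v (T (L v) x) - a n w (T (L v) x)"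
        using orbit_Suc[OF a V(2), of n] by eventually_elim (simp add: m_def)
    qed
    also have "\<dots> = mean_square (\<lambda>x. m n v x - a n w x)"
      using V by (intro mean_square_T[of "L v" "\<lambda>x. m n v x - a n w x"] bounded_measurable_borel
          bounded_measurable_diff orbit_bounded[OF a] m) auto
    also have "\<dots> = mean_square (\<lambda>x. a n w x - m n v x)"
      by (rule mean_square_minus)
    finally have eq: "mean_square (\<lambda>x. a (Suc n) v x - a n w (T (L v) x)) =
      mean_square (\<lambda>x. a n w x - m n v x)" .
    have "P v w * mean_square (\<lambda>x. a n w x - m n v x) \<le>
        (\<Sum>w\<in>V. P v w * mean_square (\<lambda>x. a n w x - m n v x))"
      using V finite_V
      by (intro member_le_sum[of w V "\<lambda>w. P v w * mean_square (\<lambda>x. a n w x - m n v x)"])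
        (auto intro!: mult_nonneg_nonneg P_nonneg mean_square_nonneg)
    then have "\<nu> v * (P v w * mean_square (\<lambda>x. a n w x - m n v x)) \<le>
        \<nu> v * (\<Sum>w\<in>V. P v w * mean_square (\<lambda>x. a n w x - m n v x))"
      using \<nu>_nonneg[OF V(2)] by (rule mult_left_mono)
    also have "\<dots> \<le> (\<Sum>v\<in>V. \<nu> v * (\<Sum>w\<in>V. P v w * mean_square (\<lambda>x. a n w x - m n v x)))"
      using V finite_V
      by (intro member_le_sum[of v V "\<lambda>v. \<nu> v * (\<Sum>w\<in>V. P v w * mean_square (\<lambda>x. a n w x - m n v x))"])
        (auto intro!: mult_nonneg_nonneg sum_nonneg P_nonneg \<nu>_nonneg mean_square_nonneg)
    also have "\<dots> = energy (a n) - energy (a (Suc n))"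
      unfolding energy_drop[OF a] m_def ..
    finally show ?thesis using pos by (simp add: eq field_simps)
  qed
  obtain q where q: "(\<lambda>n. energy (a n)) \<longlonglongrightarrow> q"
    using energy_convergent[OF a] by blast
  have "(\<lambda>n. (energy (a n) - energy (a (Suc n))) / (\<nu> v * P v w)) \<longlonglongrightarrow> (q - q) / (\<nu> v * P v w)"
    using q LIMSEQ_Suc[OF q] pos by (intro tendsto_intros) auto
  then have lim: "(\<lambda>n. (energy (a n) - energy (a (Suc n))) / (\<nu> v * P v w)) \<longlonglongrightarrow> 0" by simp
  have "(\<lambda>n. mean_square (\<lambda>x. a (Suc n) v x - a n w (T (L v) x))) \<longlonglongrightarrow> 0"
    by (rule tendsto_sandwich[OF always_eventually always_eventually tendsto_const lim])
      (use le mean_square_nonneg in auto)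
  then show ?thesis
    using V bounded_T[OF orbit_bounded[OF a V(1)] L_in[OF V(2)]] orbit_bounded[OF a V(2)]
    unfolding asymptotic_def by blast
qed

lemma path_asymptotic:
  assumes a: "orbit a" and "directed_path V E (u # s)"
  shows "(\<lambda>n. a (n + length s) (last (u # s))) \<simeq> (\<lambda>n x. a n u (T (path_label F L s) x))"
  using assms(2)
proof (induction s rule: rev_induct)
  case Nil
  then have u: "u \<in> V" by (simp add: directed_path_Cons)
  have "(\<lambda>n. a n u) \<simeq> (\<lambda>n x. a n u (T \<one> x))"
  proof (rule asymptotic_AE)
    show "AE x in M. a n u x = a n u (T \<one> x)" for n
      using T_one by eventually_elim simp
  qed (intro orbit_bounded[OF a u] bounded_T one_closed)+
  then show ?case by simp
next
  case (snoc v s)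
  have path: "directed_path V E (u # s)" "(last (u # s), v) \<in> E" "v \<in> V"
    using snoc.prems directed_path_append[of V E "u # s" "[v]"] by (auto simp: directed_path_Cons)
  have s: "set s \<subseteq> V" "u \<in> V" using path(1) by (auto simp: directed_path_def)
  have gs: "path_label F L s \<in> carrier F" using path_label_in[OF s(1)] .
  have "(\<lambda>n. a (Suc (n + length s)) v) \<simeq> (\<lambda>n x. a (n + length s) (last (u # s)) (T (L v) x))"
    using asymptotic_shift[OF edge_asymptotic[OF a path(2)], of "length s"] by simp
  also have "\<dots> \<simeq> (\<lambda>n x. a n u (T (path_label F L s) (T (L v) x)))"
    by (rule asymptotic_T[OF snoc.IH[OF path(1)] L_in[OF path(3)]])
  also have "\<dots> \<simeq> (\<lambda>n x. a n u (T (path_label F L s \<otimes> L v) x))"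
    by (rule asymptotic_sym, rule asymptotic_T_mult[OF orbit_bounded[OF a s(2)] gs L_in[OF path(3)]])
  also have "path_label F L s \<otimes> L v = path_label F L (s @ [v])"
    using s path by (simp add: path_label_append_V)
  finally show ?case by simp
qed

text \<open>
  Let \<open>\<alpha>\<close> and \<open>\<beta>\<close> be the last vertices of \<open>p\<close> and \<open>q\<close>.  Since they have the common successor \<open>w\<close>,
  the functions of the orbit at \<open>\<alpha>\<close> and \<open>\<beta>\<close> agree asymptotically.  Reaching both from \<open>u\<close>
  gives \<open>a (n + k) \<alpha> \<simeq> a n u \<circ> T\<^sub>p\<close> and \<open>a (n + k) \<beta> \<simeq> a n u \<circ> T\<^sub>q\<close>.  From \<open>\<alpha>\<close> one
  may continue along \<open>q' @ p\<close>, which leads back to \<open>\<alpha>\<close> in \<open>2 * k\<close> steps.  Replacing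
  \<open>\<alpha>\<close> by \<open>\<beta>\<close> at its start, the label accumulated from \<open>u\<close> is that of \<open>q\<close>, times its inverse,
  times that of \<open>p\<close>; hence the function at \<open>\<alpha>\<close> has returned to itself.  A path from \<open>\<alpha>\<close>
  carries the period \<open>2 * k\<close> to every other vertex.
\<close>

lemma good_subgraph_asymptotic_period:
  assumes a: "orbit a" and good: "good_subgraph F V L E k" and k: "1 \<le> k"
    and conn: "strongly_connected V E" and v: "v \<in> V"
  shows "(\<lambda>n. a (n + 2 * k) v) \<simeq> (\<lambda>n. a n v)"
proof -
  obtain u w p q p' q' where V: "u \<in> V" "w \<in> V"
    and len: "length p = k" "length q = k" "length q' = k"
    and up: "directed_path V E (u # p @ [w])" and uq: "directed_path V E (u # q @ [w])"
    and pqp: "directed_path V E (p @ q' @ p)"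
    and lab: "path_label F L q' = inv path_label F L q"
    using good unfolding good_subgraph_def by blast
  have ne: "p \<noteq> []" "q \<noteq> []" using len k by auto
  define \<alpha> \<beta> where "\<alpha> = last p" and "\<beta> = last q"
  have sub: "set p \<subseteq> V" "set q \<subseteq> V" "set q' \<subseteq> V"
    using up uq pqp by (auto simp: directed_path_def)
  have \<alpha>V: "\<alpha> \<in> V" "\<beta> \<in> V" using sub ne by (auto simp: \<alpha>_def \<beta>_def)
  have gp: "path_label F L p \<in> carrier F" and gq: "path_label F L q \<in> carrier F"
    and gqp: "path_label F L (q' @ p) \<in> carrier F"
    using sub by (auto intro!: path_label_in)
  have mult: "path_label F L q \<otimes> path_label F L (q' @ p) = path_label F L p"
    using gp gq sub by (simp add: path_label_append_V lab m_assoc[symmetric])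
  have up': "directed_path V E (u # p)" "(\<alpha>, w) \<in> E"
    using up ne directed_path_append[of V E "u # p" "[w]"] by (auto simp: \<alpha>_def)
  have uq': "directed_path V E (u # q)" "(\<beta>, w) \<in> E"
    using uq ne directed_path_append[of V E "u # q" "[w]"] by (auto simp: \<beta>_def)
  have "p @ q' @ p = butlast p @ (\<alpha> # q' @ p)"
    using ne unfolding \<alpha>_def by (metis append.assoc append_Cons append_Nil append_butlast_last_id)
  then have qp: "directed_path V E (\<alpha> # q' @ p)"
    using pqp directed_path_append[of V E "butlast p" "\<alpha> # q' @ p"] by metis
  have h1: "(\<lambda>n. a (n + k) \<alpha>) \<simeq> (\<lambda>n x. a n u (T (path_label F L p) x))"
    using path_asymptotic[OF a up'(1)] ne len by (simp add: \<alpha>_def)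
  have h2: "(\<lambda>n. a (n + k) \<beta>) \<simeq> (\<lambda>n x. a n u (T (path_label F L q) x))"
    using path_asymptotic[OF a uq'(1)] ne len by (simp add: \<beta>_def)
  have "(\<lambda>n x. a n \<alpha> (T (L w) x)) \<simeq> (\<lambda>n. a (Suc n) w)"
    by (rule asymptotic_sym[OF edge_asymptotic[OF a up'(2)]])
  also have "\<dots> \<simeq> (\<lambda>n x. a n \<beta> (T (L w) x))"
    by (rule edge_asymptotic[OF a uq'(2)])
  finally have h3: "(\<lambda>n. a n \<alpha>) \<simeq> (\<lambda>n. a n \<beta>)"
    using asymptotic_compose[OF T_measurable[OF L_in[OF V(2)]] T_distr[OF L_in[OF V(2)]]
        orbit_bounded[OF a \<alpha>V(1)] orbit_bounded[OF a \<alpha>V(2)]] by simp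
  have "(\<lambda>n. a (n + 2 * k) \<alpha>) \<simeq> (\<lambda>n x. a n \<alpha> (T (path_label F L (q' @ p)) x))"
    using path_asymptotic[OF a qp] ne len by (simp add: \<alpha>_def mult_2)
  from asymptotic_shift[OF this, of k]
  have "(\<lambda>n. a (n + k + 2 * k) \<alpha>) \<simeq> (\<lambda>n x. a (n + k) \<alpha> (T (path_label F L (q' @ p)) x))" .
  also have "\<dots> \<simeq> (\<lambda>n x. a (n + k) \<beta> (T (path_label F L (q' @ p)) x))"
    by (rule asymptotic_T[OF asymptotic_shift[OF h3] gqp])
  also have "\<dots> \<simeq> (\<lambda>n x. a n u (T (path_label F L q) (T (path_label F L (q' @ p)) x)))"
    by (rule asymptotic_T[OF h2 gqp])
  also have "\<dots> \<simeq> (\<lambda>n x. a n u (T (path_label F L p) x))"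
    using asymptotic_sym[OF asymptotic_T_mult[OF orbit_bounded[OF a V(1)] gq gqp]] unfolding mult .
  also have "\<dots> \<simeq> (\<lambda>n. a (n + k) \<alpha>)"
    by (rule asymptotic_sym[OF h1])
  finally have at_\<alpha>: "(\<lambda>n. a (n + 2 * k) \<alpha>) \<simeq> (\<lambda>n. a n \<alpha>)"
    by (rule asymptotic_unshift) (intro orbit_bounded[OF a \<alpha>V(1)])+
  obtain s where s: "directed_path V E s" "s \<noteq> []" "hd s = \<alpha>" "last s = v"
    using strongly_connected_path[OF conn _ \<alpha>V(1) v] by (auto simp: edges_def)
  then obtain t where t: "s = \<alpha> # t" by (cases s) auto
  have gt: "path_label F L t \<in> carrier F"
    using s(1) unfolding t by (intro path_label_in) (auto simp: directed_path_def)
  have at_v: "(\<lambda>n. a (n + length t) v) \<simeq> (\<lambda>n x. a n \<alpha> (T (path_label F L t) x))"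
    using path_asymptotic[OF a s(1)[unfolded t]] s(4) unfolding t by simp
  have "(\<lambda>n. a (n + length t + 2 * k) v) \<simeq> (\<lambda>n x. a (n + 2 * k) \<alpha> (T (path_label F L t) x))"
    using asymptotic_shift[OF at_v, of "2 * k"] by (simp add: ac_simps)
  also have "\<dots> \<simeq> (\<lambda>n x. a n \<alpha> (T (path_label F L t) x))"
    by (rule asymptotic_T[OF at_\<alpha> gt])
  also have "\<dots> \<simeq> (\<lambda>n. a (n + length t) v)"
    by (rule asymptotic_sym[OF at_v])
  finally show ?thesis
    by (rule asymptotic_unshift) (intro orbit_bounded[OF a v])+
qed

section \<open>Convergence of averages over a period\<close>

definition window_average :: "nat \<Rightarrow> (nat \<Rightarrow> 'v \<Rightarrow> 'x \<Rightarrow> real) \<Rightarrow> nat \<Rightarrow> 'v \<Rightarrow> 'x \<Rightarrow> real" where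
  "window_average m a n v x = 1 / real m * (\<Sum>i<m. a (n + i) v x)"

lemma orbit_window_average: "orbit a \<Longrightarrow> orbit (window_average m a)"
  unfolding window_average_def [abs_def]
  by (intro orbit_cmult orbit_sum orbit_shift)

text \<open>
  Averages over a window of length \<open>m\<close> telescope: a step changes them by
  \<open>(a (n + m) - a n) / m\<close>.
\<close>

lemma window_average_asymptotically_fixed:
  assumes a: "orbit a" and v: "v \<in> V" and period: "(\<lambda>n. a (n + m) v) \<simeq> (\<lambda>n. a n v)"
  shows "(\<lambda>n. window_average m a (Suc n) v) \<simeq> (\<lambda>n. window_average m a n v)"
proof -
  have "window_average m a (Suc n) v x - window_average m a n v x = 1 / real m * (a (n + m) v x - a n v x)"
    for n x
  proof -
    have "(\<Sum>i<m. a (Suc n + i) v x) - (\<Sum>i<m. a (n + i) v x) = a (n + m) v x - a n v x"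
      using sum_lessThan_telescope[of "\<lambda>i. a (n + i) v x" m] by (simp add: sum_subtractf)
    then show ?thesis
      by (simp add: window_average_def right_diff_distrib[symmetric] del: times_divide_eq_left)
  qed
  then have "(\<lambda>n. mean_square (\<lambda>x. window_average m a (Suc n) v x - window_average m a n v x)) =
      (\<lambda>n. (1 / real m)\<^sup>2 * mean_square (\<lambda>x. a (n + m) v x - a n v x))"
    by (simp only: mean_square_cmult)
  moreover have "\<dots> \<longlonglongrightarrow> (1 / real m)\<^sup>2 * 0"
    using period unfolding asymptotic_def by (intro tendsto_intros) simp
  ultimately show ?thesis
    using orbit_bounded[OF orbit_window_average[OF a] v] unfolding asymptotic_def by simp
qed

lemma energy_parallelogram:
  assumes "\<And>v. v \<in> V \<Longrightarrow> f v \<in> bounded_measurable M" "\<And>v. v \<in> V \<Longrightarrow> g v \<in> bounded_measurable M"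
  shows "energy (\<lambda>v x. f v x + g v x) + energy (\<lambda>v x. f v x - g v x) = 2 * energy f + 2 * energy g"
proof -
  have "energy (\<lambda>v x. f v x + g v x) + energy (\<lambda>v x. f v x - g v x) =
      (\<Sum>v\<in>V. \<nu> v * (mean_square (\<lambda>x. f v x + g v x) + mean_square (\<lambda>x. f v x - g v x)))"
    by (simp add: energy_def sum.distrib distrib_left)
  also have "\<dots> = (\<Sum>v\<in>V. \<nu> v * (2 * mean_square (f v) + 2 * mean_square (g v)))"
    using assms by (intro sum.cong) (auto simp: parallelogram)
  also have "\<dots> = 2 * energy f + 2 * energy g"
    by (simp add: energy_def sum.distrib distrib_left sum_distrib_left mult_ac)
  finally show ?thesis .
qed

lemma asymptotically_fixed_shift:
  assumes "orbit b" "v \<in> V" "(\<lambda>n. b (Suc n) v) \<simeq> (\<lambda>n. b n v)"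
  shows "(\<lambda>n. b (n + j) v) \<simeq> (\<lambda>n. b n v)"
proof (induction j)
  case 0
  show ?case using orbit_bounded[OF assms(1,2)] by (intro asymptotic_AE) auto
next
  case (Suc j)
  have "(\<lambda>n. b (n + Suc j) v) \<simeq> (\<lambda>n. b (n + j) v)"
    using asymptotic_shift[OF assms(3), of j] by simp
  then show ?case using Suc by (rule asymptotic_trans)
qed

text \<open>
  Let \<open>q\<close> be the limit of the energies of \<open>b\<close>.  For fixed \<open>j\<close> the distance of \<open>b (n + j)\<close> and
  \<open>b n\<close> tends to zero, so by the parallelogram law the energies of the orbit
  \<open>b (n + j) + b n\<close> tend to \<open>4 * q\<close>.  Being decreasing, they never fall below \<open>4 * q\<close>, and the
  parallelogram law, read the other way, bounds the distance of \<open>b (n + j)\<close> and \<open>b n\<close> by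
  \<open>4 * (energy (b n) - q)\<close>, whatever \<open>j\<close> is.  This replaces the projection onto
  fixed vectors in the mean ergodic theorem.
\<close>

lemma asymptotically_fixed_energy_Cauchy:
  assumes b: "orbit b" and fixed: "\<And>v. v \<in> V \<Longrightarrow> (\<lambda>n. b (Suc n) v) \<simeq> (\<lambda>n. b n v)" and e: "0 < e"
  shows "\<exists>N. \<forall>i\<ge>N. \<forall>j\<ge>N. energy (\<lambda>v x. b i v x - b j v x) < e"
proof -
  obtain q where q: "(\<lambda>n. energy (b n)) \<longlonglongrightarrow> q" "\<And>n. q \<le> energy (b n)"
    using energy_convergent[OF b] by blast
  have le: "energy (\<lambda>v x. b (n + j) v x - b n v x) \<le> 4 * (energy (b n) - q)" for n j
  proof -
    define s where "s n v x = b (n + j) v x + b n v x" for n v x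
    have s: "orbit s"
      unfolding s_def [abs_def] by (intro orbit_add orbit_shift b)
    have energy_s: "energy (s n) = 2 * energy (b (n + j)) + 2 * energy (b n)
        - energy (\<lambda>v x. b (n + j) v x - b n v x)" for n
      using energy_parallelogram[of "b (n + j)" "b n"] orbit_bounded[OF b] by (simp add: s_def [abs_def])
    have "(\<lambda>n. mean_square (\<lambda>x. b (n + j) v x - b n v x)) \<longlonglongrightarrow> 0" if "v \<in> V" for v
      using asymptotically_fixed_shift[OF b that fixed[OF that], of j] by (simp add: asymptotic_def)
    then have "(\<lambda>n. energy (\<lambda>v x. b (n + j) v x - b n v x)) \<longlonglongrightarrow> (\<Sum>v\<in>V. \<nu> v * 0)"
      unfolding energy_def by (intro tendsto_intros)
    then have "(\<lambda>n. energy (s n)) \<longlonglongrightarrow> 2 * q + 2 * q - (\<Sum>v\<in>V. \<nu> v * 0)"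
      unfolding energy_s by (intro tendsto_intros q(1) LIMSEQ_ignore_initial_segment)
    then have "4 * q \<le> energy (s n)"
      using decseq_ge[OF energy_decseq[OF s]] by fastforce
    moreover have "energy (b (n + j)) \<le> energy (b n)"
      using decseqD[OF energy_decseq[OF b], of n "n + j"] by simp
    ultimately show ?thesis unfolding energy_s by (simp add: right_diff_distrib)
  qed
  obtain N where N: "\<And>n. n \<ge> N \<Longrightarrow> energy (b n) < q + e / 4"
    using order_tendstoD(2)[OF q(1), of "q + e / 4"] e by (auto simp: eventually_sequentially)
  have *: "energy (\<lambda>v x. b i v x - b j v x) < e" if "j \<ge> N" "i \<ge> j" for i j
    using le[of j "i - j"] N[OF that(1)] that(2) by simp
  have "energy (\<lambda>v x. b i v x - b j v x) < e" if "i \<ge> N" "j \<ge> N" for i j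
  proof (cases "i \<ge> j")
    case False
    have "energy (\<lambda>v x. b i v x - b j v x) = energy (\<lambda>v x. b j v x - b i v x)"
      unfolding energy_def using mean_square_minus by (intro sum.cong refl) metis
    then show ?thesis using *[of i j] False that by simp
  qed (use * that in auto)
  then show ?thesis by blast
qed

lemma asymptotically_fixed_converges:
  assumes b: "orbit b" and fixed: "\<And>v. v \<in> V \<Longrightarrow> (\<lambda>n. b (Suc n) v) \<simeq> (\<lambda>n. b n v)" and v: "v \<in> V"
  shows "\<exists>h. integrable M h \<and> (\<lambda>n. \<integral>x. \<bar>b n v x - h x\<bar> \<partial>M) \<longlonglongrightarrow> 0"
proof -
  have "\<exists>N. \<forall>i\<ge>N. \<forall>j\<ge>N. (\<integral>x. \<bar>b i v x - b j v x\<bar> \<partial>M) < e" if e: "0 < e" for e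
  proof -
    have pos: "0 < \<nu> v * e\<^sup>2" using e positive[OF v] by simp
    obtain N where N: "\<And>i j. i \<ge> N \<Longrightarrow> j \<ge> N \<Longrightarrow> energy (\<lambda>v x. b i v x - b j v x) < \<nu> v * e\<^sup>2"
      using asymptotically_fixed_energy_Cauchy[OF b fixed pos] by blast
    have "(\<integral>x. \<bar>b i v x - b j v x\<bar> \<partial>M) < e" if ij: "i \<ge> N" "j \<ge> N" for i j
    proof (rule abs_integral_le_mean_square[OF _ e])
      show "(\<lambda>x. b i v x - b j v x) \<in> bounded_measurable M"
        by (intro bounded_measurable_diff orbit_bounded[OF b v])
      have "\<nu> v * mean_square (\<lambda>x. b i v x - b j v x) < \<nu> v * e\<^sup>2"
        using weighted_mean_square_le_energy[OF v, of "\<lambda>v x. b i v x - b j v x"] N[OF ij] by linarith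
      then show "mean_square (\<lambda>x. b i v x - b j v x) < e\<^sup>2"
        using positive[OF v] by simp
    qed
    then show ?thesis by blast
  qed
  then obtain h where "integrable M h" "(\<lambda>n. \<integral>x. \<bar>b n v x - h x\<bar> \<partial>M) \<longlonglongrightarrow> 0"
    by (rule L1_Cauchy_converges[of "\<lambda>n. b n v", OF bounded_measurable_integrable[OF orbit_bounded[OF b v]]])
  then show ?thesis by blast
qed

section \<open>Identification of the limit\<close>

lemma asymptotic_imp_L1:
  assumes "f \<simeq> g" shows "(\<lambda>n. \<integral>x. \<bar>f n x - g n x\<bar> \<partial>M) \<longlonglongrightarrow> 0"
proof (rule LIMSEQ_I)
  fix e :: real assume e: "0 < e"
  have lim: "(\<lambda>n. mean_square (\<lambda>x. f n x - g n x)) \<longlonglongrightarrow> 0"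
    and bm: "(\<lambda>x. f n x - g n x) \<in> bounded_measurable M" for n
    using assms by (auto simp: asymptotic_def)
  have "0 < e\<^sup>2" using e by simp
  then obtain N where "\<And>n. n \<ge> N \<Longrightarrow> mean_square (\<lambda>x. f n x - g n x) < e\<^sup>2"
    using order_tendstoD(2)[OF lim, of "e\<^sup>2"] by (auto simp: eventually_sequentially)
  then have "(\<integral>x. \<bar>f n x - g n x\<bar> \<partial>M) < e" if "n \<ge> N" for n
    using abs_integral_le_mean_square[OF bm e] that by blast
  then show "\<exists>N. \<forall>n\<ge>N. norm ((\<integral>x. \<bar>f n x - g n x\<bar> \<partial>M) - 0) < e"
    by (intro exI[of _ N]) simp
qed

text \<open>
  The asymptotic relation along an edge becomes an identity in the limit, because
  mean-square convergence implies convergence in mean.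
\<close>

lemma limit_along_edge:
  assumes b: "orbit b"
    and h: "\<And>v. v \<in> V \<Longrightarrow> integrable M (h v)"
    and lim: "\<And>v. v \<in> V \<Longrightarrow> (\<lambda>n. \<integral>x. \<bar>b n v x - h v x\<bar> \<partial>M) \<longlonglongrightarrow> 0"
    and wv: "(w, v) \<in> E"
  shows "AE x in M. h v x = h w (T (L v) x)"
proof -
  note V = edgesD(1,2)[OF wv]
  have Lv: "L v \<in> carrier F" using V by simp
  have bint: "integrable M (b n u)" if "u \<in> V" for n u
    using bounded_measurable_integrable[OF orbit_bounded[OF b that]] .
  note intT = integrable_T[OF _ Lv]
  define d where "d = (\<lambda>x. \<bar>h v x - h w (T (L v) x)\<bar>)"
  have d: "integrable M d"
    unfolding d_def using h V by (intro integrable_abs Bochner_Integration.integrable_diff intT) auto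
  let ?d1 = "\<lambda>n x. \<bar>b (Suc n) v x - h v x\<bar>"
  let ?d2 = "\<lambda>n x. \<bar>b (Suc n) v x - b n w (T (L v) x)\<bar>"
  let ?d3 = "\<lambda>n x. \<bar>b n w (T (L v) x) - h w (T (L v) x)\<bar>"
  have int: "integrable M (?d1 n)" "integrable M (?d2 n)" "integrable M (?d3 n)" for n
    using h V by (intro integrable_abs Bochner_Integration.integrable_diff intT bint; simp)+
  have le: "(\<integral>x. d x \<partial>M) \<le> (\<integral>x. ?d1 n x \<partial>M) + (\<integral>x. ?d2 n x \<partial>M) + (\<integral>x. \<bar>b n w x - h w x\<bar> \<partial>M)" for n
  proof -
    have "(\<integral>x. d x \<partial>M) \<le> (\<integral>x. ?d1 n x + ?d2 n x + ?d3 n x \<partial>M)"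
      using d int by (intro integral_mono Bochner_Integration.integrable_add) (auto simp: d_def)
    also have "\<dots> = (\<integral>x. ?d1 n x \<partial>M) + (\<integral>x. ?d2 n x \<partial>M) + (\<integral>x. ?d3 n x \<partial>M)"
      using int by simp
    also have "(\<integral>x. ?d3 n x \<partial>M) = (\<integral>x. \<bar>b n w x - h w x\<bar> \<partial>M)"
      using integral_T[OF Lv, of "\<lambda>x. \<bar>b n w x - h w x\<bar>"] bint[OF V(1)] h[OF V(1)] by auto
    finally show ?thesis .
  qed
  have "(\<lambda>n. (\<integral>x. ?d1 n x \<partial>M) + (\<integral>x. ?d2 n x \<partial>M) + (\<integral>x. \<bar>b n w x - h w x\<bar> \<partial>M)) \<longlonglongrightarrow> 0 + 0 + 0"
    by (intro tendsto_add LIMSEQ_Suc[OF lim[OF V(2)]] lim[OF V(1)]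
        asymptotic_imp_L1[OF edge_asymptotic[OF b wv]])
  then have "(\<integral>x. d x \<partial>M) \<le> 0"
    by (intro LIMSEQ_le_const) (use le in auto)
  then have "(\<integral>x. d x \<partial>M) = 0"
    by (intro antisym Bochner_Integration.integral_nonneg) (auto simp: d_def)
  then have "AE x in M. d x = 0"
    using integral_nonneg_eq_0_iff_AE[OF d] by (simp add: d_def)
  then show ?thesis by eventually_elim (simp add: d_def)
qed

lemma fixed_along_path:
  assumes edge: "\<And>v w. (w, v) \<in> E \<Longrightarrow> AE x in M. h v x = h w (T (L v) x)"
    and "directed_path V E (u # s)"
  shows "AE x in M. h (last (u # s)) x = h u (T (path_label F L s) x)"
  using assms(2)
proof (induction s rule: rev_induct)
  case Nil
  show ?case using T_one by (auto elim!: eventually_mono)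
next
  case (snoc v s)
  have path: "directed_path V E (u # s)" "(last (u # s), v) \<in> E" "v \<in> V"
    using snoc.prems directed_path_append[of V E "u # s" "[v]"] by (auto simp: directed_path_Cons)
  have s: "set s \<subseteq> V" using path(1) by (auto simp: directed_path_def)
  have "AE x in M. h v x = h (last (u # s)) (T (L v) x)" by (rule edge[OF path(2)])
  moreover have "AE x in M. h (last (u # s)) (T (L v) x) = h u (T (path_label F L s) (T (L v) x))"
    by (rule AE_T[OF L_in[OF path(3)] snoc.IH[OF path(1)]])
  moreover have "AE x in M. T (path_label F L s \<otimes> L v) x = T (path_label F L s) (T (L v) x)"
    by (rule T_mult[OF path_label_in[OF s] L_in[OF path(3)]])
  moreover have "path_label F L (s @ [v]) = path_label F L s \<otimes> L v"
    using s path by (simp add: path_label_append_V)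
  ultimately show ?case by (auto elim!: eventually_elim2)
qed

text \<open>
  All predecessors of \<open>v\<close> carry the same function \<open>c = h v \<circ> T\<^sub>v\<^sup>-\<^sup>1\<close>.  A loop \<open>p\<close> at \<open>v\<close>, entered from
  its own last vertex, leads from one predecessor of \<open>v\<close> to itself, so \<open>c\<close> is invariant
  under \<open>T\<^sub>p\<close>, and hence under the group that these labels generate.  If that is the whole
  group, then moving along edges does not change \<open>c\<close> either.
\<close>

lemma fixed_is_invariant:
  assumes edge: "\<And>v w. (w, v) \<in> E \<Longrightarrow> AE x in M. h v x = h w (T (L v) x)"
    and conn: "strongly_connected V E"
    and v: "v \<in> V" and loop: "loop_group F V L E v = carrier F"
  shows "\<And>g. g \<in> carrier F \<Longrightarrow> AE x in M. h v (T g x) = h v x"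
    and "\<And>w. w \<in> V \<Longrightarrow> AE x in M. h w x = h v x"
proof -
  have Lv: "L v \<in> carrier F" using v by simp
  define c where "c x = h v (T (inv (L v)) x)" for x
  have cancel: "AE x in M. T g (T (inv g) x) = x" "AE x in M. T (inv g) (T g x) = x"
    if "g \<in> carrier F" for g
    using T_mult[of g "inv g"] T_mult[of "inv g" g] T_one that by auto
  have along: "AE x in M. h (last (u # s)) x = h u (T (path_label F L s) x)"
    if "directed_path V E (u # s)" for u s
    by (rule fixed_along_path[OF _ that]) (rule edge)
  have pred: "AE x in M. h w x = c x" if "(w, v) \<in> E" for w
    using AE_T[OF inv_closed[OF Lv] edge[OF that]] cancel(1)[OF Lv]
    by eventually_elim (simp add: c_def)
  define loops where "loops = {path_label F L p | p.
      directed_path V E p \<and> p \<noteq> [] \<and> hd p = v \<and> (last p, v) \<in> E}"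
  have loops: "g \<in> carrier F" "AE x in M. c (T g x) = c x" if g_loop: "g \<in> loops" for g
  proof -
    obtain p where p: "directed_path V E p" "p \<noteq> []" "hd p = v" "(last p, v) \<in> E"
      and g: "g = path_label F L p" using g_loop unfolding loops_def by blast
    have path: "directed_path V E (last p # p)"
      using p edgesD(1)[OF p(4)] by (simp add: directed_path_Cons)
    show gF: "g \<in> carrier F"
      using p(1) unfolding g directed_path_def by (intro path_label_in) auto
    show "AE x in M. c (T g x) = c x"
      using along[OF path] pred[OF p(4)] AE_T[OF gF pred[OF p(4)]]
      by eventually_elim (use p(2) g in simp)
  qed
  have gen: "AE x in M. c (T g x) = c x" if "g \<in> generate F loops" for g
    using that
  proof (induction rule: generate.induct)
    case one
    show ?case using T_one by eventually_elim simp
  next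
    case (incl g)
    then show ?case by (rule loops(2))
  next
    case (inv g)
    have gF: "g \<in> carrier F" by (rule loops(1)[OF inv])
    from AE_T[OF inv_closed[OF gF] loops(2)[OF inv]] show ?case
      using cancel(1)[OF gF] by eventually_elim simp
  next
    case (eng g h)
    then have gh: "g \<in> carrier F" "h \<in> carrier F"
      using loop unfolding loop_group_def loops_def by auto
    show ?case
      using T_mult[OF gh] AE_T[OF gh(2) eng.IH(1)] eng.IH(2) by eventually_elim simp
  qed
  have c: "AE x in M. c (T g x) = c x" if "g \<in> carrier F" for g
    using gen[of g] that loop unfolding loop_group_def loops_def by simp
  have hv: "AE x in M. h v x = c x"
    using c[OF Lv] cancel(2)[OF Lv] by eventually_elim (simp add: c_def)
  show "AE x in M. h v (T g x) = h v x" if "g \<in> carrier F" for g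
    using c[OF that] hv AE_T[OF that hv] by eventually_elim simp
  show "AE x in M. h w x = h v x" if w: "w \<in> V" for w
  proof -
    obtain s where s: "directed_path V E s" "s \<noteq> []" "hd s = v" "last s = w"
      using strongly_connected_path[OF conn _ v w] by (auto simp: edges_def)
    then obtain t where t: "s = v # t" by (cases s) auto
    have gt: "path_label F L t \<in> carrier F"
      using s(1) unfolding t by (intro path_label_in) (auto simp: directed_path_def)
    show ?thesis
      using along[OF s(1)[unfolded t]] c[OF gt] hv AE_T[OF gt hv]
      by eventually_elim (use s(4) t in simp)
  qed
qed

end

lemma invariant_algebra_subalgebra:
  fixes M :: "'x measure"
  assumes "pmp_action F M T"
  shows "subalgebra M (invariant_algebra F M T)"
  using assms sets_invariant_algebra[OF assms]
  unfolding subalgebra_def by (auto simp: invariant_algebra_def space_measure_of_conv)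

lemma measurable_invariant_algebra:
  fixes c :: "'x \<Rightarrow> real"
  assumes act: "pmp_action F M T" and c: "c \<in> borel_measurable M"
    and inv: "\<And>g. g \<in> carrier F \<Longrightarrow> AE x in M. c (T g x) = c x"
  shows "c \<in> borel_measurable (invariant_algebra F M T)"
proof (rule measurableI)
  fix B :: "real set" assume B: "B \<in> sets borel"
  have space: "space (invariant_algebra F M T) = space M"
    by (simp add: invariant_algebra_def space_measure_of_conv)
  have "AE x in M. T g x \<in> c -` B \<inter> space M \<longleftrightarrow> x \<in> c -` B \<inter> space M" if g: "g \<in> carrier F" for g
  proof -
    have "T g \<in> measurable M M" using act g by (simp add: pmp_action_def)
    then have Tx: "T g x \<in> space M" if "x \<in> space M" for x using that by (rule measurable_space)
    show ?thesis using inv[OF g] AE_space by eventually_elim (use Tx in simp)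
  qed
  then show "c -` B \<inter> space (invariant_algebra F M T) \<in> sets (invariant_algebra F M T)"
    unfolding space sets_invariant_algebra[OF act] using measurable_sets[OF c B] by blast
qed simp

context markov_action
begin

abbreviation "\<I> \<equiv> invariant_algebra F M T"

sublocale Inv: sigma_finite_subalgebra M \<I>
  using invariant_algebra_subalgebra[OF action]
  by (intro finite_measure_subalgebra_is_sigma_finite)
    (simp add: finite_measure_subalgebra_def finite_measure_subalgebra_axioms_def finite_measure_axioms)

text \<open>
  The Markov operator averages and moves points within an invariant set, so it preserves
  integrals over that set if these agree at all vertices.
\<close>

lemma orbit_integral_invariant_set:
  assumes a: "orbit a" and A: "A \<in> sets \<I>"
    and 0: "\<And>v. v \<in> V \<Longrightarrow> (\<integral>x. indicator A x * a 0 v x \<partial>M) = \<kappa>" and v: "v \<in> V"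
  shows "(\<integral>x. indicator A x * a n v x \<partial>M) = \<kappa>"
  using v
proof (induction n arbitrary: v)
  case 0
  then show ?case using assms(3) by simp
next
  case (Suc n)
  have AM: "A \<in> sets M" and inv: "AE x in M. T (L v) x \<in> A \<longleftrightarrow> x \<in> A"
    using A Suc.prems unfolding sets_invariant_algebra[OF action] by auto
  have bm: "(\<lambda>x. indicator A x * a n w x) \<in> bounded_measurable M" if "w \<in> V" for w n
    using AM that by (intro bounded_measurable_mult orbit_bounded[OF a] bounded_measurableI[of _ _ 1])
      (auto simp: indicator_def)
  have "(\<integral>x. indicator A x * a (Suc n) v x \<partial>M) =
      (\<integral>x. (\<Sum>w\<in>V. P v w * (indicator A (T (L v) x) * a n w (T (L v) x))) \<partial>M)"
  proof (rule integral_cong_AE)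
    show "(\<lambda>x. indicator A x * a (Suc n) v x) \<in> borel_measurable M"
      by (rule bounded_measurable_borel[OF bm[OF Suc.prems]])
    show "(\<lambda>x. \<Sum>w\<in>V. P v w * (indicator A (T (L v) x) * a n w (T (L v) x))) \<in> borel_measurable M"
      by (intro bounded_measurable_borel bounded_measurable_sum bounded_measurable_mult[OF bounded_measurable_const])
        (rule bounded_T[OF bm L_in[OF Suc.prems]])
    show "AE x in M. indicator A x * a (Suc n) v x =
        (\<Sum>w\<in>V. P v w * (indicator A (T (L v) x) * a n w (T (L v) x)))"
      using orbit_Suc[OF a Suc.prems, of n] inv
      by eventually_elim (auto simp: indicator_def sum_distrib_left)
  qed
  also have "\<dots> = (\<Sum>w\<in>V. \<integral>x. P v w * (indicator A (T (L v) x) * a n w (T (L v) x)) \<partial>M)"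
  proof (rule Bochner_Integration.integral_sum)
    fix w assume w: "w \<in> V"
    show "integrable M (\<lambda>x. P v w * (indicator A (T (L v) x) * a n w (T (L v) x)))"
      by (rule integrable_mult_right)
        (rule bounded_measurable_integrable[OF bounded_T[OF bm[OF w] L_in[OF Suc.prems]]])
  qed
  also have "\<dots> = (\<Sum>w\<in>V. P v w * \<kappa>)"
  proof (rule sum.cong[OF refl])
    fix w assume w: "w \<in> V"
    have "(\<integral>x. indicator A (T (L v) x) * a n w (T (L v) x) \<partial>M) = (\<integral>x. indicator A x * a n w x \<partial>M)"
      by (rule integral_T[OF L_in[OF Suc.prems] bounded_measurable_borel[OF bm[OF w]]])
    then show "(\<integral>x. P v w * (indicator A (T (L v) x) * a n w (T (L v) x)) \<partial>M) = P v w * \<kappa>"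
      using Suc.IH[OF w] by simp
  qed
  also have "\<dots> = \<kappa>" by (simp add: sum_distrib_right[symmetric] P_sum[OF Suc.prems])
  finally show ?case .
qed

text \<open>
  The limit is an invariant function, the same at all vertices.  Its integrals over
  invariant sets are those of \<open>\<phi>\<close>, which characterizes the conditional expectation.
\<close>

lemma window_average_converges_to_cond_exp:
  assumes a: "orbit a" and \<phi>: "\<phi> \<in> bounded_measurable M"
    and start: "\<And>v. v \<in> V \<Longrightarrow> AE x in M. a 0 v x = \<phi> (T (L v) x)"
    and period: "\<And>v. v \<in> V \<Longrightarrow> (\<lambda>n. a (n + m) v) \<simeq> (\<lambda>n. a n v)" and m: "1 \<le> m"
    and conn: "strongly_connected V E"
    and loop: "v\<^sub>0 \<in> V" "loop_group F V L E v\<^sub>0 = carrier F" and v: "v \<in> V"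
  shows "(\<lambda>n. \<integral>x. \<bar>window_average m a n v x - real_cond_exp M \<I> \<phi> x\<bar> \<partial>M) \<longlonglongrightarrow> 0"
proof -
  define b where "b = window_average m a"
  have b: "orbit b" unfolding b_def by (rule orbit_window_average[OF a])
  have fixed: "(\<lambda>n. b (Suc n) v) \<simeq> (\<lambda>n. b n v)" if "v \<in> V" for v
    unfolding b_def by (rule window_average_asymptotically_fixed[OF a that period[OF that]])
  have "\<forall>v\<in>V. \<exists>h. integrable M h \<and> (\<lambda>n. \<integral>x. \<bar>b n v x - h x\<bar> \<partial>M) \<longlonglongrightarrow> 0"
    using asymptotically_fixed_converges[OF b fixed] by blast
  then obtain h where
    "\<forall>v\<in>V. integrable M (h v) \<and> (\<lambda>n. \<integral>x. \<bar>b n v x - h v x\<bar> \<partial>M) \<longlonglongrightarrow> 0"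
    unfolding bchoice_iff by blast
  then have h: "\<And>v. v \<in> V \<Longrightarrow> integrable M (h v)"
    and lim: "\<And>v. v \<in> V \<Longrightarrow> (\<lambda>n. \<integral>x. \<bar>b n v x - h v x\<bar> \<partial>M) \<longlonglongrightarrow> 0"
    by blast+
  have edge: "AE x in M. h v x = h w (T (L v) x)" if "(w, v) \<in> E" for v w
    by (rule limit_along_edge[OF b _ _ that]) (use h lim in auto)
  have inv: "AE x in M. h v\<^sub>0 (T g x) = h v\<^sub>0 x" if "g \<in> carrier F" for g
    by (rule fixed_is_invariant(1)[OF _ conn loop that]) (rule edge)
  have const: "AE x in M. h w x = h v\<^sub>0 x" if "w \<in> V" for w
    by (rule fixed_is_invariant(2)[OF _ conn loop that]) (rule edge)
  have meas: "h v\<^sub>0 \<in> borel_measurable \<I>"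
    using h[OF loop(1)] by (intro measurable_invariant_algebra[OF action _ inv]) auto
  have \<phi>_int: "integrable M \<phi>" by (rule bounded_measurable_integrable[OF \<phi>])
  have "AE x in M. real_cond_exp M \<I> \<phi> x = h v\<^sub>0 x"
  proof (rule Inv.real_cond_exp_charact[OF _ \<phi>_int h[OF loop(1)] meas])
    fix A assume A: "A \<in> sets \<I>"
    have AM: "A \<in> sets M" using A unfolding sets_invariant_algebra[OF action] by simp
    have ind: "(\<lambda>x. indicator A x) \<in> bounded_measurable M"
      using AM by (intro bounded_measurableI[of _ _ 1]) (auto simp: indicator_def)
    define \<kappa> where "\<kappa> = (\<integral>x. indicator A x * \<phi> x \<partial>M)"
    have a0: "(\<integral>x. indicator A x * a 0 v x \<partial>M) = \<kappa>" if v: "v \<in> V" for v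
    proof -
      have inv: "AE x in M. T (L v) x \<in> A \<longleftrightarrow> x \<in> A"
        using A v unfolding sets_invariant_algebra[OF action] by auto
      have bm: "(\<lambda>x. indicator A x * \<phi> x) \<in> bounded_measurable M"
        by (intro bounded_measurable_mult ind \<phi>)
      have "(\<integral>x. indicator A x * a 0 v x \<partial>M) = (\<integral>x. indicator A (T (L v) x) * \<phi> (T (L v) x) \<partial>M)"
      proof (rule integral_cong_AE)
        show "(\<lambda>x. indicator A x * a 0 v x) \<in> borel_measurable M"
          by (intro bounded_measurable_borel bounded_measurable_mult ind orbit_bounded[OF a v])
        show "(\<lambda>x. indicator A (T (L v) x) * \<phi> (T (L v) x)) \<in> borel_measurable M"
          by (rule bounded_measurable_borel[OF bounded_T[OF bm L_in[OF v]]])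
        show "AE x in M. indicator A x * a 0 v x = indicator A (T (L v) x) * \<phi> (T (L v) x)"
          using inv start[OF v] by eventually_elim (auto simp: indicator_def)
      qed
      also have "\<dots> = \<kappa>"
        unfolding \<kappa>_def by (rule integral_T[OF L_in[OF v] bounded_measurable_borel[OF bm]])
      finally show ?thesis .
    qed
    have b_int: "integrable M (b n v\<^sub>0)" for n
      by (rule bounded_measurable_integrable[OF orbit_bounded[OF b loop(1)]])
    have int_b: "(\<integral>x. indicator A x * b n v\<^sub>0 x \<partial>M) = \<kappa>" for n
    proof -
      have "(\<integral>x. indicator A x * b n v\<^sub>0 x \<partial>M) =
          (\<integral>x. 1 / real m * (\<Sum>i<m. indicator A x * a (n + i) v\<^sub>0 x) \<partial>M)"
        by (simp only: b_def window_average_def sum_distrib_left[symmetric] mult.left_commute)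
      also have "\<dots> = 1 / real m * (\<Sum>i<m. \<integral>x. indicator A x * a (n + i) v\<^sub>0 x \<partial>M)"
        by (subst integral_mult_right_zero, subst Bochner_Integration.integral_sum)
          (intro bounded_measurable_integrable bounded_measurable_mult ind orbit_bounded[OF a loop(1)] refl)+
      also have "\<dots> = \<kappa>"
        using m by (simp add: orbit_integral_invariant_set[OF a A a0 loop(1)])
      finally show ?thesis .
    qed
    have ind_int: "integrable M (\<lambda>x. indicator A x * f x)" if "integrable M f" for f :: "'x \<Rightarrow> real"
      using integrable_mult_indicator[OF AM that] by simp
    have "\<bar>\<kappa> - (\<integral>x. indicator A x * h v\<^sub>0 x \<partial>M)\<bar> \<le> (\<integral>x. \<bar>b n v\<^sub>0 x - h v\<^sub>0 x\<bar> \<partial>M)" for n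
    proof -
      have "\<kappa> - (\<integral>x. indicator A x * h v\<^sub>0 x \<partial>M) =
          (\<integral>x. indicator A x * (b n v\<^sub>0 x - h v\<^sub>0 x) \<partial>M)"
        unfolding int_b[of n, symmetric] right_diff_distrib
        by (rule Bochner_Integration.integral_diff[symmetric]) (intro ind_int b_int h loop)+
      also have "\<bar>\<dots>\<bar> \<le> (\<integral>x. \<bar>b n v\<^sub>0 x - h v\<^sub>0 x\<bar> \<partial>M)"
        using h[OF loop(1)] b_int
        by (intro order_trans[OF integral_abs_bound] integral_mono ind_int integrable_abs Bochner_Integration.integrable_diff)
          (auto simp: indicator_def)
      finally show ?thesis by simp
    qed
    then have "\<bar>\<kappa> - (\<integral>x. indicator A x * h v\<^sub>0 x \<partial>M)\<bar> \<le> 0"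
      by (intro LIMSEQ_le_const[OF lim[OF loop(1)]]) auto
    then show "(\<integral>x\<in>A. \<phi> x \<partial>M) = (\<integral>x\<in>A. h v\<^sub>0 x \<partial>M)"
      by (simp add: \<kappa>_def set_lebesgue_integral_def)
  qed
  then have "AE x in M. h v x = real_cond_exp M \<I> \<phi> x"
    using const[OF v] by eventually_elim simp
  then have "(\<integral>x. \<bar>b n v x - real_cond_exp M \<I> \<phi> x\<bar> \<partial>M) = (\<integral>x. \<bar>b n v x - h v x\<bar> \<partial>M)" for n
    using h[OF v] bounded_measurable_borel[OF orbit_bounded[OF b v]]
    by (intro integral_cong_AE) (auto elim!: eventually_mono)
  then show ?thesis using lim[OF v] by (simp add: b_def)
qed

section \<open>Spherical averages\<close>

definition paths_to :: "nat \<Rightarrow> 'v \<Rightarrow> 'v list set" where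
  "paths_to n v = {s. set s \<subseteq> V \<and> length s = Suc n \<and> last s = v}"

lemma finite_paths_to [simp]: "finite (paths_to n v)"
  by (rule finite_subset[OF _ finite_lists_length_eq[OF finite_V, of "Suc n"]]) (auto simp: paths_to_def)

lemma paths_to_0: "v \<in> V \<Longrightarrow> paths_to 0 v = {[v]}"
  by (auto simp: paths_to_def length_Suc_conv)

lemma path_weight_snoc:
  assumes "s \<noteq> []" shows "path_weight P (s @ [v]) = path_weight P s * P v (last s)"
proof -
  obtain l where l: "length s = Suc l" using assms by (cases s) auto
  then have last: "last s = s ! l" using assms by (simp add: last_conv_nth)
  have "path_weight P (s @ [v]) = (\<Prod>i<Suc l. P ((s @ [v]) ! Suc i) ((s @ [v]) ! i))"
    by (simp add: path_weight_def l)
  also have "\<dots> = (\<Prod>i<l. P ((s @ [v]) ! Suc i) ((s @ [v]) ! i)) * P v (last s)"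
    using l last by (simp add: nth_append)
  also have "(\<Prod>i<l. P ((s @ [v]) ! Suc i) ((s @ [v]) ! i)) = path_weight P s"
    using l by (auto simp: path_weight_def nth_append intro!: prod.cong)
  finally show ?thesis .
qed

lemma sum_paths_to_Suc:
  assumes "v \<in> V"
  shows "(\<Sum>s\<in>paths_to (Suc n) v. f s) = (\<Sum>w\<in>V. \<Sum>s\<in>paths_to n w. f (s @ [v]))"
proof -
  have "paths_to (Suc n) v = (\<lambda>s. s @ [v]) ` (\<Union>w\<in>V. paths_to n w)"
  proof (intro equalityI subsetI)
    fix s assume s: "s \<in> paths_to (Suc n) v"
    then have "s \<noteq> []" by (auto simp: paths_to_def)
    then have eq: "s = butlast s @ [v]"
      using s append_butlast_last_id[of s] by (simp add: paths_to_def)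
    have "butlast s \<noteq> []" "set (butlast s) \<subseteq> V" "length (butlast s) = Suc n"
      using s by (auto simp: paths_to_def dest: in_set_butlastD simp flip: length_0_conv)
    then show "s \<in> (\<lambda>s. s @ [v]) ` (\<Union>w\<in>V. paths_to n w)"
      using eq last_in_set[of "butlast s"] by (intro image_eqI[of _ _ "butlast s"]) (auto simp: paths_to_def)
  qed (use assms in \<open>auto simp: paths_to_def\<close>)
  then have "(\<Sum>s\<in>paths_to (Suc n) v. f s) = (\<Sum>s\<in>(\<Union>w\<in>V. paths_to n w). f (s @ [v]))"
    by (simp add: sum.reindex inj_on_def)
  also have "\<dots> = (\<Sum>w\<in>V. \<Sum>s\<in>paths_to n w. f (s @ [v]))"
    by (rule sum.UNION_disjoint[OF finite_V]) (simp, auto simp: paths_to_def)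
  finally show ?thesis .
qed

lemma sum_sequences_by_last:
  "(\<Sum>s | set s \<subseteq> V \<and> length s = Suc n. f s) = (\<Sum>v\<in>V. \<Sum>s\<in>paths_to n v. f s)"
proof -
  have "{s. set s \<subseteq> V \<and> length s = Suc n} = (\<Union>v\<in>V. paths_to n v)"
    by (auto simp: paths_to_def) (metis last_in_set length_greater_0_conv subsetD zero_less_Suc)
  then show ?thesis
    by simp (rule sum.UNION_disjoint[OF finite_V], simp, auto simp: paths_to_def)
qed

text \<open>
  The part of the spherical average of order \<open>n + 1\<close> that comes from the sequences ending in \<open>v\<close>,
  without the factor \<open>\<nu> v\<close>.  The index is shifted as the empty sequence has no last vertex.
\<close>

definition sphere_orbit :: "('x \<Rightarrow> real) \<Rightarrow> nat \<Rightarrow> 'v \<Rightarrow> 'x \<Rightarrow> real" where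
  "sphere_orbit \<phi> n v x = (\<Sum>s\<in>paths_to n v. path_weight P s * \<phi> (T (path_label F L s) x))"

lemma spherical_average_Suc:
  "spherical_average F V L P \<nu> T (Suc n) \<phi> x = (\<Sum>v\<in>V. \<nu> v * sphere_orbit \<phi> n v x)"
  unfolding spherical_average_def sum_sequences_by_last sphere_orbit_def sum_distrib_left
  by (intro sum.cong) (auto simp: paths_to_def)

lemma sphere_orbit_0: "v \<in> V \<Longrightarrow> AE x in M. sphere_orbit \<phi> 0 v x = \<phi> (T (L v) x)"
  by (simp add: sphere_orbit_def paths_to_0 path_weight_def)

lemma paths_to_label: "s \<in> paths_to n v \<Longrightarrow> path_label F L s \<in> carrier F"
  by (intro path_label_in) (simp add: paths_to_def)

text \<open>
  Appending \<open>v\<close> to a sequence multiplies its weight by \<open>P v (last s)\<close> and its label by \<open>L v\<close>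
  on the right, that is, it precomposes with \<open>T (L v)\<close>.
\<close>

lemma orbit_sphere_orbit:
  assumes \<phi>: "\<phi> \<in> bounded_measurable M"
  shows "orbit (sphere_orbit \<phi>)"
  unfolding orbit_def
proof (intro conjI allI ballI)
  fix n v assume v: "v \<in> V"
  show "sphere_orbit \<phi> n v \<in> bounded_measurable M"
    unfolding sphere_orbit_def [abs_def]
    by (intro bounded_measurable_sum bounded_measurable_mult bounded_measurable_const bounded_T[OF \<phi>] paths_to_label)
  have "AE x in M. \<forall>w\<in>V. \<forall>s\<in>paths_to n w.
      T (path_label F L (s @ [v])) x = T (path_label F L s) (T (L v) x)"
  proof (intro AE_finite_allI finite_V finite_paths_to)
    fix w s assume "s \<in> paths_to n w"
    then have "set s \<subseteq> V" by (simp add: paths_to_def)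
    then show "AE x in M. T (path_label F L (s @ [v])) x = T (path_label F L s) (T (L v) x)"
      using T_mult[OF path_label_in L_in[OF v]] v by (simp add: path_label_append_V)
  qed
  then show "AE x in M. sphere_orbit \<phi> (Suc n) v x =
      (\<Sum>w\<in>V. P v w * sphere_orbit \<phi> n w (T (L v) x))"
  proof eventually_elim
    case (elim x)
    have "sphere_orbit \<phi> (Suc n) v x =
        (\<Sum>w\<in>V. \<Sum>s\<in>paths_to n w. path_weight P (s @ [v]) * \<phi> (T (path_label F L (s @ [v])) x))"
      unfolding sphere_orbit_def sum_paths_to_Suc[OF v] ..
    also have "\<dots> = (\<Sum>w\<in>V. \<Sum>s\<in>paths_to n w. P v w * (path_weight P s * \<phi> (T (path_label F L s) (T (L v) x))))"
    proof (intro sum.cong refl)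
      fix w s assume w: "w \<in> V" and s: "s \<in> paths_to n w"
      then have "s \<noteq> []" "last s = w" by (auto simp: paths_to_def)
      then show "path_weight P (s @ [v]) * \<phi> (T (path_label F L (s @ [v])) x) =
          P v w * (path_weight P s * \<phi> (T (path_label F L s) (T (L v) x)))"
        using elim w s by (simp add: path_weight_snoc)
    qed
    finally show ?case by (simp add: sphere_orbit_def sum_distrib_left)
  qed
qed

end

section \<open>Passage to integrable functions\<close>

lemma integrable_approx_bounded:
  fixes f :: "'x \<Rightarrow> real"
  assumes f: "integrable M f" and e: "0 < e"
  obtains g where "g \<in> bounded_measurable M" "(\<integral>x. \<bar>f x - g x\<bar> \<partial>M) < e"
proof -
  define g where "g m x = max (- real m) (min (real m) (f x))" for m x
  have g: "g m \<in> bounded_measurable M" for m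
    using f unfolding g_def [abs_def] by (intro bounded_measurableI[of _ _ "real m"]) auto
  have "(\<lambda>m. \<integral>x. \<bar>f x - g m x\<bar> \<partial>M) \<longlonglongrightarrow> (\<integral>x. 0 \<partial>M)"
  proof (rule integral_dominated_convergence[where w = "\<lambda>x. \<bar>f x\<bar>"])
    show "AE x in M. (\<lambda>m. \<bar>f x - g m x\<bar>) \<longlonglongrightarrow> 0"
    proof (intro AE_I2 tendsto_eventually)
      fix x
      obtain N :: nat where "\<bar>f x\<bar> \<le> real N" using real_arch_simple by blast
      then show "\<forall>\<^sub>F m in sequentially. \<bar>f x - g m x\<bar> = 0"
        unfolding eventually_sequentially g_def by (intro exI[of _ N]) auto
    qed
    show "AE x in M. norm \<bar>f x - g m x\<bar> \<le> \<bar>f x\<bar>" for m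
      by (intro AE_I2) (auto simp: g_def)
  qed (use f g bounded_measurable_borel in \<open>auto intro!: borel_measurable_abs borel_measurable_diff\<close>)
  then obtain m where "(\<integral>x. \<bar>f x - g m x\<bar> \<partial>M) < e"
    using order_tendstoD(2)[of _ "0::real" sequentially e] e by (auto simp: eventually_sequentially)
  then show ?thesis using that g by blast
qed

lemma convex_combination_L1:
  fixes c :: "'i \<Rightarrow> real" and u :: "'i \<Rightarrow> 'x \<Rightarrow> real"
  assumes "\<And>i. i \<in> I \<Longrightarrow> 0 \<le> c i" "(\<Sum>i\<in>I. c i) = 1"
    and u: "\<And>i. i \<in> I \<Longrightarrow> integrable M (u i)" and B: "\<And>i. i \<in> I \<Longrightarrow> (\<integral>x. \<bar>u i x\<bar> \<partial>M) \<le> B"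
  shows "integrable M (\<lambda>x. \<Sum>i\<in>I. c i * u i x)" and "(\<integral>x. \<bar>\<Sum>i\<in>I. c i * u i x\<bar> \<partial>M) \<le> B"
proof -
  have int: "integrable M (\<lambda>x. c i * u i x)" "integrable M (\<lambda>x. c i * \<bar>u i x\<bar>)" if "i \<in> I" for i
    using u[OF that] by auto
  then show int_sum: "integrable M (\<lambda>x. \<Sum>i\<in>I. c i * u i x)" by simp
  have "(\<integral>x. \<bar>\<Sum>i\<in>I. c i * u i x\<bar> \<partial>M) \<le> (\<integral>x. (\<Sum>i\<in>I. c i * \<bar>u i x\<bar>) \<partial>M)"
  proof (rule integral_mono)
    show "\<bar>\<Sum>i\<in>I. c i * u i x\<bar> \<le> (\<Sum>i\<in>I. c i * \<bar>u i x\<bar>)" for x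
      using assms(1) by (intro order_trans[OF sum_abs] sum_mono) (simp add: abs_mult)
  qed (use int int_sum in auto)
  also have "\<dots> = (\<Sum>i\<in>I. c i * (\<integral>x. \<bar>u i x\<bar> \<partial>M))"
    using int by (subst Bochner_Integration.integral_sum) auto
  also have "\<dots> \<le> (\<Sum>i\<in>I. c i * B)"
    using assms(1) B by (intro sum_mono mult_left_mono) auto
  also have "\<dots> = B" using assms(2) by (simp add: sum_distrib_right[symmetric])
  finally show "(\<integral>x. \<bar>\<Sum>i\<in>I. c i * u i x\<bar> \<partial>M) \<le> B" .
qed

lemma (in sigma_finite_subalgebra) real_cond_exp_L1_contraction:
  assumes f: "integrable M f"
  shows "(\<integral>x. \<bar>real_cond_exp M F f x\<bar> \<partial>M) \<le> (\<integral>x. \<bar>f x\<bar> \<partial>M)"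
proof -
  have [measurable]: "f \<in> borel_measurable M" using f by simp
  have "(\<integral>\<^sup>+x. ennreal \<bar>real_cond_exp M F f x\<bar> \<partial>M) \<le>
      (\<integral>\<^sup>+x. 1 * nn_cond_exp M F (\<lambda>x. ennreal \<bar>f x\<bar>) x \<partial>M)"
    using real_cond_exp_abs[of f] by (intro nn_integral_mono_AE) auto
  also have "\<dots> = (\<integral>\<^sup>+x. 1 * ennreal \<bar>f x\<bar> \<partial>M)"
    by (rule nn_cond_exp_intg) auto
  also have "\<dots> = ennreal (\<integral>x. \<bar>f x\<bar> \<partial>M)"
    using f by (simp add: nn_integral_eq_integral)
  finally have "ennreal (\<integral>x. \<bar>real_cond_exp M F f x\<bar> \<partial>M) \<le> ennreal (\<integral>x. \<bar>f x\<bar> \<partial>M)"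
    using real_cond_exp_int(1)[OF f] by (simp add: nn_integral_eq_integral)
  then show ?thesis by simp
qed

context markov_action
begin

lemma sphere_orbit_L1:
  assumes f: "integrable M f" and v: "v \<in> V"
  shows "integrable M (sphere_orbit f n v)" and "(\<integral>x. \<bar>sphere_orbit f n v x\<bar> \<partial>M) \<le> (\<integral>x. \<bar>f x\<bar> \<partial>M)"
proof -
  have "0 \<le> path_weight P s" if "set s \<subseteq> V" for s
  proof -
    have "s ! i \<in> V" if "i < length s" for i using nth_mem[OF that] \<open>set s \<subseteq> V\<close> by blast
    then show ?thesis unfolding path_weight_def by (intro prod_nonneg) (auto intro!: P_nonneg)
  qed
  then have pos: "0 \<le> path_weight P s" if "s \<in> paths_to n v" for s n v
    using that by (simp add: paths_to_def)
  have sum: "(\<Sum>s\<in>paths_to n v. path_weight P s) = 1"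
    using v
  proof (induction n arbitrary: v)
    case 0
    then show ?case by (simp add: paths_to_0 path_weight_def)
  next
    case (Suc n)
    have "(\<Sum>s\<in>paths_to (Suc n) v. path_weight P s) =
        (\<Sum>w\<in>V. \<Sum>s\<in>paths_to n w. path_weight P (s @ [v]))"
      by (rule sum_paths_to_Suc[OF Suc.prems])
    also have "\<dots> = (\<Sum>w\<in>V. \<Sum>s\<in>paths_to n w. path_weight P s * P v w)"
    proof (intro sum.cong refl)
      fix w s assume "s \<in> paths_to n w"
      then have "s \<noteq> []" "last s = w" by (auto simp: paths_to_def)
      then show "path_weight P (s @ [v]) = path_weight P s * P v w" by (simp add: path_weight_snoc)
    qed
    also have "\<dots> = (\<Sum>w\<in>V. P v w)"
      by (simp add: sum_distrib_right[symmetric] Suc.IH)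
    finally show ?case using P_sum[OF Suc.prems] by simp
  qed
  have int: "integrable M (\<lambda>x. f (T (path_label F L s) x))"
    and le: "(\<integral>x. \<bar>f (T (path_label F L s) x)\<bar> \<partial>M) \<le> (\<integral>x. \<bar>f x\<bar> \<partial>M)"
    if "s \<in> paths_to n v" for s
    using integrable_T[OF f paths_to_label[OF that]]
      integral_T[OF paths_to_label[OF that], of "\<lambda>x. \<bar>f x\<bar>"] f by auto
  show "integrable M (sphere_orbit f n v)"
    unfolding sphere_orbit_def [abs_def]
    by (rule convex_combination_L1(1)[OF pos sum int le])
  show "(\<integral>x. \<bar>sphere_orbit f n v x\<bar> \<partial>M) \<le> (\<integral>x. \<bar>f x\<bar> \<partial>M)"
    unfolding sphere_orbit_def by (rule convex_combination_L1(2)[OF pos sum int le])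
qed

definition cesaro_average :: "nat \<Rightarrow> ('x \<Rightarrow> real) \<Rightarrow> nat \<Rightarrow> 'x \<Rightarrow> real" where
  "cesaro_average m f n x = (\<Sum>v\<in>V. \<nu> v * window_average m (sphere_orbit f) n v x)"

lemma cesaro_average_spherical:
  assumes "1 \<le> k"
  shows "1 / (2 * real k) * (\<Sum>i = 0..2 * k - 1. spherical_average F V L P \<nu> T (Suc n + i) f x) =
    cesaro_average (2 * k) f n x"
proof -
  have "{0..2 * k - 1} = {..<2 * k}" using assms by auto
  then have "1 / (2 * real k) * (\<Sum>i = 0..2 * k - 1. spherical_average F V L P \<nu> T (Suc n + i) f x) =
      1 / real (2 * k) * (\<Sum>i<2 * k. \<Sum>v\<in>V. \<nu> v * sphere_orbit f (n + i) v x)"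
    by (simp add: spherical_average_Suc)
  also have "\<dots> = cesaro_average (2 * k) f n x"
    unfolding cesaro_average_def window_average_def
    by (subst sum.swap) (simp only: sum_distrib_left mult.left_commute)
  finally show ?thesis .
qed

lemma cesaro_average_L1:
  assumes f: "integrable M f" and m: "1 \<le> m"
  shows "integrable M (cesaro_average m f n)"
    and "(\<integral>x. \<bar>cesaro_average m f n x\<bar> \<partial>M) \<le> (\<integral>x. \<bar>f x\<bar> \<partial>M)"
proof -
  have sum: "(\<Sum>i<m. 1 / real m) = 1" using m by simp
  have window: "integrable M (window_average m (sphere_orbit f) n v)"
    "(\<integral>x. \<bar>window_average m (sphere_orbit f) n v x\<bar> \<partial>M) \<le> (\<integral>x. \<bar>f x\<bar> \<partial>M)"
    if "v \<in> V" for v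
    using convex_combination_L1[OF _ sum sphere_orbit_L1(1)[OF f that] sphere_orbit_L1(2)[OF f that], of "\<lambda>i. n + i"]
    unfolding window_average_def [abs_def] sum_distrib_left by auto
  show "integrable M (cesaro_average m f n)"
    unfolding cesaro_average_def [abs_def]
    by (rule convex_combination_L1(1)[OF \<nu>_nonneg \<nu>_sum window])
  show "(\<integral>x. \<bar>cesaro_average m f n x\<bar> \<partial>M) \<le> (\<integral>x. \<bar>f x\<bar> \<partial>M)"
    unfolding cesaro_average_def by (rule convex_combination_L1(2)[OF \<nu>_nonneg \<nu>_sum window])
qed

lemma cesaro_average_diff:
  "cesaro_average m (\<lambda>x. f x - g x) n x = cesaro_average m f n x - cesaro_average m g n x"
  by (simp add: cesaro_average_def window_average_def sphere_orbit_def right_diff_distrib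
      sum_subtractf diff_divide_distrib)

text \<open>
  The averages and the conditional expectation are contractions of \<open>L\<^sup>1\<close>, so it is enough to
  treat a bounded function \<open>g\<close> close to \<open>f\<close>, and for \<open>g\<close> the windows at each vertex converge.
\<close>

theorem cesaro_average_converges:
  assumes f: "integrable M f" and good: "good_subgraph F V L E k" and k: "1 \<le> k"
    and conn: "strongly_connected V E"
    and loop: "v\<^sub>0 \<in> V" "loop_group F V L E v\<^sub>0 = carrier F"
  shows "(\<lambda>n. \<integral>x. \<bar>cesaro_average (2 * k) f n x - real_cond_exp M \<I> f x\<bar> \<partial>M) \<longlonglongrightarrow> 0"
proof (rule LIMSEQ_I)
  fix e :: real assume e: "0 < e"
  define m where "m = 2 * k"
  have m: "1 \<le> m" using k by (simp add: m_def)
  obtain g where g: "g \<in> bounded_measurable M" and fg: "(\<integral>x. \<bar>f x - g x\<bar> \<partial>M) < e / 4"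
    using integrable_approx_bounded[OF f, of "e / 4"] e by auto
  have gi: "integrable M g" by (rule bounded_measurable_integrable[OF g])
  have fgi: "integrable M (\<lambda>x. f x - g x)" using f gi by simp
  have orb: "orbit (sphere_orbit g)" by (rule orbit_sphere_orbit[OF g])
  define d where "d n v = (\<lambda>x. window_average m (sphere_orbit g) n v x - real_cond_exp M \<I> g x)" for n v
  have di: "integrable M (d n v)" if "v \<in> V" for n v
    using bounded_measurable_integrable[OF orbit_bounded[OF orbit_window_average[OF orb] that]]
      Inv.real_cond_exp_int(1)[OF gi] unfolding d_def by simp
  have "(\<lambda>n. \<integral>x. \<bar>d n v x\<bar> \<partial>M) \<longlonglongrightarrow> 0" if v: "v \<in> V" for v
    unfolding d_def m_def
    using good_subgraph_asymptotic_period[OF orb good k conn] sphere_orbit_0 k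
    by (intro window_average_converges_to_cond_exp[OF orb g _ _ _ conn loop v]) auto
  then have "\<forall>v\<in>V. \<forall>\<^sub>F n in sequentially. (\<integral>x. \<bar>d n v x\<bar> \<partial>M) < e / 4"
    using order_tendstoD(2)[of _ "0::real" sequentially "e / 4"] e by simp
  then have "\<forall>\<^sub>F n in sequentially. \<forall>v\<in>V. (\<integral>x. \<bar>d n v x\<bar> \<partial>M) < e / 4"
    by (rule eventually_ball_finite[OF finite_V])
  then obtain N where N: "\<And>n v. n \<ge> N \<Longrightarrow> v \<in> V \<Longrightarrow> (\<integral>x. \<bar>d n v x\<bar> \<partial>M) < e / 4"
    by (auto simp: eventually_sequentially)
  have "norm ((\<integral>x. \<bar>cesaro_average m f n x - real_cond_exp M \<I> f x\<bar> \<partial>M) - 0) < e" if n: "n \<ge> N" for n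
  proof -
    let ?d1 = "cesaro_average m (\<lambda>x. f x - g x) n"
    let ?d2 = "\<lambda>x. \<Sum>v\<in>V. \<nu> v * d n v x"
    let ?d3 = "real_cond_exp M \<I> (\<lambda>x. f x - g x)"
    have d2: "?d2 x = cesaro_average m g n x - real_cond_exp M \<I> g x" for x
      by (simp add: d_def cesaro_average_def right_diff_distrib sum_subtractf sum_distrib_right[symmetric] \<nu>_sum)
    have b1: "integrable M ?d1" "(\<integral>x. \<bar>?d1 x\<bar> \<partial>M) \<le> e / 4"
      using cesaro_average_L1[OF fgi m, of n] fg by auto
    have b2: "integrable M ?d2" "(\<integral>x. \<bar>?d2 x\<bar> \<partial>M) \<le> e / 4"
      using convex_combination_L1[OF \<nu>_nonneg \<nu>_sum di less_imp_le[OF N[OF n]]] by auto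
    have b3: "integrable M ?d3" "(\<integral>x. \<bar>?d3 x\<bar> \<partial>M) \<le> e / 4"
      using Inv.real_cond_exp_int(1)[OF fgi] Inv.real_cond_exp_L1_contraction[OF fgi] fg by auto
    have "integrable M (\<lambda>x. \<bar>cesaro_average m f n x - real_cond_exp M \<I> f x\<bar>)"
      using cesaro_average_L1(1)[OF f m] Inv.real_cond_exp_int(1)[OF f] by auto
    then have "(\<integral>x. \<bar>cesaro_average m f n x - real_cond_exp M \<I> f x\<bar> \<partial>M) \<le>
        (\<integral>x. \<bar>?d1 x\<bar> + \<bar>?d2 x\<bar> + \<bar>?d3 x\<bar> \<partial>M)"
    proof (rule integral_mono_AE)
      show "integrable M (\<lambda>x. \<bar>?d1 x\<bar> + \<bar>?d2 x\<bar> + \<bar>?d3 x\<bar>)"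
        using b1(1) b2(1) b3(1) by (intro Bochner_Integration.integrable_add integrable_abs)
      show "AE x in M. \<bar>cesaro_average m f n x - real_cond_exp M \<I> f x\<bar> \<le>
          \<bar>?d1 x\<bar> + \<bar>?d2 x\<bar> + \<bar>?d3 x\<bar>"
        using Inv.real_cond_exp_diff[OF f gi]
      proof eventually_elim
        case (elim x)
        show ?case unfolding d2 elim cesaro_average_diff by linarith
      qed
    qed
    also have "\<dots> = (\<integral>x. \<bar>?d1 x\<bar> \<partial>M) + (\<integral>x. \<bar>?d2 x\<bar> \<partial>M) + (\<integral>x. \<bar>?d3 x\<bar> \<partial>M)"
      by (simp only: Bochner_Integration.integral_add Bochner_Integration.integrable_add
          integrable_abs b1(1) b2(1) b3(1))
    also have "\<dots> < e" using b1(2) b2(2) b3(2) e by linarith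
    finally show ?thesis by simp
  qed
  then show "\<exists>N. \<forall>n\<ge>N. norm ((\<integral>x. \<bar>cesaro_average (2 * k) f n x - real_cond_exp M \<I> f x\<bar> \<partial>M) - 0) < e"
    unfolding m_def by blast
qed

end

section \<open>Good subgraphs and the mean ergodic theorem\<close>

theorem proposition1p2:
  fixes F :: "('g, 'm) monoid_scheme"
    and V :: "'v set"
    and L :: "'v \<Rightarrow> 'g"
    and P :: "'v \<Rightarrow> 'v \<Rightarrow> real"
    and \<nu> :: "'v \<Rightarrow> real"
    and E :: "('v \<times> 'v) set"
  assumes "fg_free_group F"
    and "finite V"
    and "L ` V \<subseteq> carrier F"
    and "inj_on L V"
    and "stochastic V P"
    and "stationary_distribution V P \<nu>"
    and "\<forall>v\<in>V. 0 < \<nu> v"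
    and "E = edges V P"
    and "strongly_connected V E"
    and "\<forall>(a, b)\<in>E. \<exists>a' b'. inverse_vertex F V L a a' \<and> inverse_vertex F V L b b' \<and> (b', a') \<in> E"
    and "\<exists>v\<in>V. \<exists>w\<in>V. \<exists>u\<in>V. (v, w) \<in> E \<and> (u, w) \<in> E \<and>
           (\<exists>v'. inverse_vertex F V L v v' \<and> (u, v') \<in> E)"
  shows "(\<exists>k\<ge>1. good_subgraph F V L E k) \<and>
    ((\<exists>v\<in>V. loop_group F V L E v = carrier F) \<longrightarrow>
      (\<forall>k\<ge>1. good_subgraph F V L E k \<longrightarrow>
        (\<forall>(M :: 'x measure) T f. pmp_action F M T \<and> integrable M f \<longrightarrow>
          converges_in_L1 M
            (\<lambda>n x. 1 / (2 * real k) * (\<Sum>i = 0..2 * k - 1. spherical_average F V L P \<nu> T (n + i) f x))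
            (real_cond_exp M (invariant_algebra F M T) f))))"
proof (intro conjI impI allI)
  have grp: "group F" using assms(1) by (simp add: fg_free_group_def)
  obtain v w u v' where "(v, w) \<in> E" "(u, w) \<in> E" "inverse_vertex F V L v v'" "(u, v') \<in> E"
    using assms(11) by blast
  moreover have "E \<subseteq> V \<times> V" using assms(8) by (auto simp: edges_def)
  ultimately show "\<exists>k\<ge>1. good_subgraph F V L E k"
    using group.good_subgraph_exists[OF grp assms(3,4) _ assms(9,10)] by blast
next
  fix k :: nat and M :: "'x measure" and T :: "'g \<Rightarrow> 'x \<Rightarrow> 'x" and f :: "'x \<Rightarrow> real"
  assume "\<exists>v\<in>V. loop_group F V L E v = carrier F" and k: "1 \<le> k" and good: "good_subgraph F V L E k"
    and "pmp_action F M T \<and> integrable M f"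
  then obtain v where loop: "v \<in> V" "loop_group F V L (edges V P) v = carrier F"
    and action: "pmp_action F M T" and f: "integrable M f"
    unfolding assms(8) by blast
  interpret group F using assms(1) by (simp add: fg_free_group_def)
  interpret prob_space M using action by (simp add: pmp_action_def)
  interpret markov_action F M V L P \<nu> T
    by unfold_locales (use assms action in auto)
  let ?S = "\<lambda>n x. 1 / (2 * real k) *
    (\<Sum>i = 0..2 * k - 1. spherical_average F V L P \<nu> T (n + i) f x)"
  let ?h = "real_cond_exp M (invariant_algebra F M T) f"
  have eq: "(\<integral>\<^sup>+x. ennreal \<bar>?S (Suc n) x - ?h x\<bar> \<partial>M) =
      ennreal (\<integral>x. \<bar>cesaro_average (2 * k) f n x - ?h x\<bar> \<partial>M)" for n
    unfolding cesaro_average_spherical[OF k]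
    using cesaro_average_L1(1)[OF f, of "2 * k" n] k Inv.real_cond_exp_int(1)[OF f]
    by (intro nn_integral_eq_integral) auto
  have "(\<lambda>n. ennreal (\<integral>x. \<bar>cesaro_average (2 * k) f n x - ?h x\<bar> \<partial>M)) \<longlonglongrightarrow> ennreal 0"
    using cesaro_average_converges[OF f _ k _ loop] good assms(9)
    unfolding assms(8) by (intro tendsto_ennrealI)
  then have "(\<lambda>n. \<integral>\<^sup>+x. ennreal \<bar>?S (Suc n) x - ?h x\<bar> \<partial>M) \<longlonglongrightarrow> 0"
    unfolding eq by simp
  then show "converges_in_L1 M ?S ?h"
    unfolding converges_in_L1_def by (rule LIMSEQ_imp_Suc)
qed

end
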